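(* Let $d\in\mathbb{N}$, let $\Lambda\subset[0,\infty)$ be an additive semigroup with $0\in\Lambda$, and let $\omega$ be an admissible weight on $\Lambda$. An element $f\in\mathcal{D}(\Lambda,\omega,M_d(\mathbb{C}))$ has an inverse in $\mathcal{D}(\Lambda,\omega,M_d(\mathbb{C}))$ if and only if $\overline{\{f(s):s\in\mathcal{H}\}}\subset GL_d(\mathbb{C})$.
   Context: $\mathcal{H}=\{s\in\mathbb C:\operatorname{Re}s\geq 0\}$. $M_d(\mathbb C)$ is the Banach algebra of complex $d\times d$ matrices with operator norm, unit $I_d$; $GL_d(\mathbb C)$ is the set of invertible matrices. A weight on $\Lambda$ is a map $\omega:\Lambda\to[1,\infty)$ with $\omega(0)=1$ and $\omega(\lambda_1+\lambda_2)\le\omega(\lambda_1)\omega(\lambda_2)$ for all $\lambda_1,\lambda_2\in\Lambda$; it is admissible if $\lim_{n\to\infty}\omega(n\lambda)^{1/n}=1$ for all $\lambda\in\Lambda$. For a unital Banach algebra $\mathcal A$, $\mathcal D(\Lambda,\omega,\mathcal A)$ is the set of functions $f:\mathcal H\to\mathcal A$ of the form $f(s)=\sum_{\lambda\in\Lambda}f_\lambda e^{-\lambda s}$ with $f_\lambda\in\mathcal A$ and $\|f\|_\omega=\sum_{\lambda\in\Lambda}\|f_\lambda\|\omega(\lambda)<\infty$; it is a unital Banach algebra under pointwise multiplication and $\|\cdot\|_\omega$. *)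

theory Defs
  imports "HOL-Analysis.Analysis"
begin

definition opnorm :: "complex^'n::finite^'n \<Rightarrow> real" where
  "opnorm A = onorm (\<lambda>x::complex^'n. A *v x)"

definition cscale :: "complex \<Rightarrow> complex^'n::finite^'n \<Rightarrow> complex^'n^'n" where
  "cscale c A = (\<chi> i j. c * A $ i $ j)"

definition right_half_plane :: "complex set" where
  "right_half_plane = {s. Re s \<ge> 0}"

definition additive_semigroup0 :: "real set \<Rightarrow> bool" where
  "additive_semigroup0 \<Lambda> \<longleftrightarrow> \<Lambda> \<subseteq> {0..} \<and> 0 \<in> \<Lambda> \<and> (\<forall>a\<in>\<Lambda>. \<forall>b\<in>\<Lambda>. a + b \<in> \<Lambda>)"

definition weight :: "real set \<Rightarrow> (real \<Rightarrow> real) \<Rightarrow> bool" where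
  "weight \<Lambda> \<omega> \<longleftrightarrow> (\<forall>l\<in>\<Lambda>. \<omega> l \<ge> 1) \<and> \<omega> 0 = 1 \<and>
     (\<forall>a\<in>\<Lambda>. \<forall>b\<in>\<Lambda>. \<omega> (a + b) \<le> \<omega> a * \<omega> b)"

definition admissible_weight :: "real set \<Rightarrow> (real \<Rightarrow> real) \<Rightarrow> bool" where
  "admissible_weight \<Lambda> \<omega> \<longleftrightarrow> weight \<Lambda> \<omega> \<and>
     (\<forall>l\<in>\<Lambda>. (\<lambda>n. root n (\<omega> (real n * l))) \<longlonglongrightarrow> 1)"

text \<open>D(\<Lambda>,\<omega>,M_d(C)): functions on the closed right half plane given by an
  absolutely \<omega>-summable generalized Dirichlet series (values off H are irrelevant).\<close>
definition dirichlet_algebra ::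
  "real set \<Rightarrow> (real \<Rightarrow> real) \<Rightarrow> (complex \<Rightarrow> complex^'n::finite^'n) set" where
  "dirichlet_algebra \<Lambda> \<omega> = {f. \<exists>F :: real \<Rightarrow> complex^'n^'n.
      (\<lambda>l. opnorm (F l) * \<omega> l) summable_on \<Lambda> \<and>
      (\<forall>s\<in>right_half_plane. f s = (\<Sum>\<^sub>\<infinity>l\<in>\<Lambda>. cscale (exp (- (complex_of_real l * s))) (F l)))}"

end

theory Submission
  imports Defs "HOL-Complex_Analysis.Conformal_Mappings" "HOL-Real_Asymp.Real_Asymp"
begin

text \<open>
  Cramer's rule reduces the statement to scalar series: if \<open>\<bar>f\<bar>\<close> is bounded below on the half plane,
  then \<open>1 / f\<close> is again a weighted series. Write \<open>f = P - E\<close> with a Dirichlet polynomial \<open>P\<close> and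
  \<open>E\<close> of small norm, and expand \<open>1 / f\<close> in powers of \<open>E\<close>; this converges as soon as the norms of
  \<open>1 / P ^ n\<close> grow like \<open>C * \<delta> powr - n\<close>, where \<open>\<delta>\<close> is slightly below the infimum of \<open>\<bar>P\<bar>\<close>.
  Being a polynomial, \<open>P\<close> is bounded below by \<open>\<delta>\<close> even on a slightly larger half plane
  \<open>Re s > - \<alpha>\<close>. The frequencies of \<open>1 / P ^ n\<close> lie in a finitely generated semigroup \<open>L\<close>, and
  shifting the line in the mean value formula for the coefficients bounds the coefficient of
  frequency \<open>l\<close> by \<open>\<delta> powr - n * exp (- \<beta> * l)\<close> for \<open>\<beta> < \<alpha>\<close>. By admissibility
  \<open>exp (- \<beta> * l) * \<omega> l\<close> is summable over \<open>L\<close>.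
\<close>

section \<open>Scalar Dirichlet series with a bound on their weighted norm\<close>

text \<open>\<open>K\<close> is only an upper bound for the weighted norm of some coefficient
  family. Bounds can thus be multiplied and summed without knowing that \<open>f\<close> determines
  its coefficients.\<close>

definition dirichlet_sum ::
  "real set \<Rightarrow> (real \<Rightarrow> real) \<Rightarrow> real \<Rightarrow> (complex \<Rightarrow> complex) \<Rightarrow> bool" where
  "dirichlet_sum \<Lambda> \<omega> K f \<longleftrightarrow> (\<exists>F. (\<lambda>l. norm (F l) * \<omega> l) summable_on \<Lambda> \<and>
      (\<Sum>\<^sub>\<infinity>l\<in>\<Lambda>. norm (F l) * \<omega> l) \<le> K \<and>
      (\<forall>s\<in>right_half_plane. ((\<lambda>l. F l * exp (- (of_real l * s))) has_sum f s) \<Lambda>))"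

lemma norm_exp_le_1:
  assumes "s \<in> right_half_plane" "l \<ge> 0"
  shows "norm (exp (- (complex_of_real l * s))) \<le> 1"
  using assms by (simp add: right_half_plane_def)

lemma summable_on_product_real:
  fixes f :: "'a \<Rightarrow> real" and g :: "'b \<Rightarrow> real"
  assumes "f summable_on A" "g summable_on B"
    and "\<And>x. x \<in> A \<Longrightarrow> f x \<ge> 0" "\<And>y. y \<in> B \<Longrightarrow> g y \<ge> 0"
  shows "(\<lambda>(x, y). f x * g y) summable_on (A \<times> B)"
proof (rule summable_on_SigmaI)
  show "((\<lambda>y. case (x, y) of (x, y) \<Rightarrow> f x * g y) has_sum f x * infsum g B) B" for x
    using assms by (auto intro!: has_sum_cmult_right)
  show "(\<lambda>x. f x * infsum g B) summable_on A"
    by (intro summable_on_cmult_left assms)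
qed (use assms in auto)

text \<open>The locale serves both the given data and, in the study of Dirichlet polynomials, a
  subsemigroup with the constant weight 1. Admissibility is a separate hypothesis of the lemmas
  about the growth of \<open>\<omega>\<close>.\<close>

locale dirichlet_weight =
  fixes \<Lambda> :: "real set" and \<omega> :: "real \<Rightarrow> real"
  assumes semigroup: "additive_semigroup0 \<Lambda>" and weight: "weight \<Lambda> \<omega>"
begin

lemma nonneg: "l \<in> \<Lambda> \<Longrightarrow> l \<ge> 0"
  and zero_in: "0 \<in> \<Lambda>"
  and add_in: "a \<in> \<Lambda> \<Longrightarrow> b \<in> \<Lambda> \<Longrightarrow> a + b \<in> \<Lambda>"
  using semigroup by (auto simp: additive_semigroup0_def)

lemma weight_ge_1: "l \<in> \<Lambda> \<Longrightarrow> \<omega> l \<ge> 1"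
  and weight_0: "\<omega> 0 = 1"
  and weight_add: "a \<in> \<Lambda> \<Longrightarrow> b \<in> \<Lambda> \<Longrightarrow> \<omega> (a + b) \<le> \<omega> a * \<omega> b"
  using weight by (auto simp: weight_def)

lemma summable_unweighted:
  assumes "(\<lambda>i. norm (c i) * \<omega> (\<phi> i)) summable_on I" "\<And>i. i \<in> I \<Longrightarrow> \<phi> i \<in> \<Lambda>"
  shows "(\<lambda>i. norm (c i)) summable_on I"
  by (rule summable_on_comparison_test[OF assms(1)])
    (use weight_ge_1 assms(2) in \<open>auto intro!: mult_left_le simp: mult_le_cancel_left1\<close>)

lemma summable_evaluate:
  fixes c :: "'i \<Rightarrow> complex"
  assumes "(\<lambda>i. norm (c i) * \<omega> (\<phi> i)) summable_on I" "\<And>i. i \<in> I \<Longrightarrow> \<phi> i \<in> \<Lambda>"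
    and "s \<in> right_half_plane"
  shows "(\<lambda>i. norm (c i * exp (- (of_real (\<phi> i) * s)))) summable_on I"
proof (rule summable_on_comparison_test[OF summable_unweighted[OF assms(1,2)]])
  fix i assume "i \<in> I"
  then have "norm (exp (- (of_real (\<phi> i) * s))) \<le> 1"
    by (intro norm_exp_le_1 assms nonneg)
  then show "norm (c i * exp (- (of_real (\<phi> i) * s))) \<le> norm (c i)"
    by (simp add: norm_mult mult_left_le del: norm_exp_eq_Re)
qed auto

text \<open>Grouping the terms of equal frequency does not increase the norm. Products and series of
  Dirichlet series arise in this way, with pairs as indices.\<close>

lemma dirichlet_sumI:
  fixes c :: "'i \<Rightarrow> complex"
  assumes \<phi>: "\<And>i. i \<in> I \<Longrightarrow> \<phi> i \<in> \<Lambda>"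
    and summ: "(\<lambda>i. norm (c i) * \<omega> (\<phi> i)) summable_on I"
    and le: "(\<Sum>\<^sub>\<infinity>i\<in>I. norm (c i) * \<omega> (\<phi> i)) \<le> K"
    and f: "\<And>s. s \<in> right_half_plane \<Longrightarrow>
             ((\<lambda>i. c i * exp (- (of_real (\<phi> i) * s))) has_sum f s) I"
  shows "dirichlet_sum \<Lambda> \<omega> K f"
proof -
  \<comment> \<open>\<open>B l\<close> is the fibre of \<open>\<phi>\<close> over the frequency
    \<open>l\<close>. Summing along the fibres first yields the coefficients \<open>F\<close>, and
    \<open>N\<close> is the weighted majorant of \<open>F\<close> obtained in the same way.\<close>
  define B where "B = (\<lambda>l. {i\<in>I. \<phi> i = l})"
  define F where "F = (\<lambda>l. infsum c (B l))"
  define N where "N = (\<lambda>l. \<Sum>\<^sub>\<infinity>i\<in>B l. norm (c i) * \<omega> l)"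
  have BI: "B l \<subseteq> I" for l
    by (auto simp: B_def)
  have bij: "bij_betw snd (Sigma \<Lambda> B) I"
    using \<phi> by (auto simp: bij_betw_def inj_on_def B_def image_iff)
  have c: "(\<lambda>i. norm (c i)) summable_on B l" for l
    by (rule summable_on_subset_banach[OF summable_unweighted[OF summ \<phi>] BI])
  have "(N has_sum (\<Sum>\<^sub>\<infinity>i\<in>I. norm (c i) * \<omega> (\<phi> i))) \<Lambda>"
  proof (rule has_sum_SigmaD)
    show "((\<lambda>p. norm (c (snd p)) * \<omega> (\<phi> (snd p))) has_sum (\<Sum>\<^sub>\<infinity>i\<in>I. norm (c i) * \<omega> (\<phi> i))) (Sigma \<Lambda> B)"
      using has_sum_infsum[OF summ] by (subst has_sum_reindex_bij_betw[OF bij])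
    show "((\<lambda>y. norm (c (snd (x, y))) * \<omega> (\<phi> (snd (x, y)))) has_sum N x) (B x)" for x
    proof -
      have "(\<lambda>y. norm (c y) * \<omega> x) summable_on (B x)"
        by (intro summable_on_cmult_left c)
      then have "((\<lambda>y. norm (c y) * \<omega> x) has_sum N x) (B x)"
        unfolding N_def by (rule has_sum_infsum)
      then show ?thesis
        by (rule has_sum_cong[THEN iffD1, rotated]) (auto simp: B_def)
    qed
  qed
  then have N: "N summable_on \<Lambda>" "infsum N \<Lambda> \<le> K"
    using le by (auto simp: has_sum_iff)
  have FN: "norm (F l) * \<omega> l \<le> N l" if "l \<in> \<Lambda>" for l
  proof -
    have "norm (F l) * \<omega> l \<le> (\<Sum>\<^sub>\<infinity>i\<in>B l. norm (c i)) * \<omega> l"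
      unfolding F_def using weight_ge_1[OF that] by (intro mult_right_mono norm_infsum_bound c) auto
    also have "\<dots> = N l"
      unfolding N_def by (subst infsum_cmult_left) (use c in auto)
    finally show ?thesis .
  qed
  have F: "(\<lambda>l. norm (F l) * \<omega> l) summable_on \<Lambda>"
    by (rule summable_on_comparison_test[OF N(1) FN]) (use weight_ge_1 in \<open>fastforce+\<close>)
  show ?thesis
    unfolding dirichlet_sum_def
  proof (intro exI[of _ F] conjI ballI F)
    have "(\<Sum>\<^sub>\<infinity>l\<in>\<Lambda>. norm (F l) * \<omega> l) \<le> infsum N \<Lambda>"
      by (rule infsum_mono[OF F N(1) FN])
    then show "(\<Sum>\<^sub>\<infinity>l\<in>\<Lambda>. norm (F l) * \<omega> l) \<le> K"
      using N by simp
    fix s assume s: "s \<in> right_half_plane"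
    show "((\<lambda>l. F l * exp (- (of_real l * s))) has_sum f s) \<Lambda>"
    proof (rule has_sum_SigmaD)
      show "((\<lambda>p. c (snd p) * exp (- (of_real (\<phi> (snd p)) * s))) has_sum f s) (Sigma \<Lambda> B)"
        using f[OF s] by (subst has_sum_reindex_bij_betw[OF bij])
      show "((\<lambda>i. c (snd (l, i)) * exp (- (of_real (\<phi> (snd (l, i))) * s)))
              has_sum F l * exp (- (of_real l * s))) (B l)" for l
      proof -
        have "((\<lambda>i. c i * exp (- (of_real l * s))) has_sum F l * exp (- (of_real l * s))) (B l)"
          unfolding F_def by (intro has_sum_cmult_left has_sum_infsum abs_summable_summable[OF c])
        then show ?thesis
          by (rule has_sum_cong[THEN iffD1, rotated]) (auto simp: B_def)
      qed
    qed
  qed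
qed

lemma dirichlet_sum_cong:
  assumes "dirichlet_sum \<Lambda> \<omega> K f" "\<And>s. s \<in> right_half_plane \<Longrightarrow> f s = g s"
  shows "dirichlet_sum \<Lambda> \<omega> K g"
  using assms unfolding dirichlet_sum_def by auto

lemma dirichlet_sum_nonneg:
  assumes "dirichlet_sum \<Lambda> \<omega> K f" shows "K \<ge> 0"
proof -
  obtain F :: "real \<Rightarrow> complex" where "(\<Sum>\<^sub>\<infinity>l\<in>\<Lambda>. norm (F l) * \<omega> l) \<le> K"
    using assms unfolding dirichlet_sum_def by blast
  moreover have "(\<Sum>\<^sub>\<infinity>l\<in>\<Lambda>. norm (F l) * \<omega> l) \<ge> 0"
    by (rule infsum_nonneg) (use weight_ge_1 in \<open>fastforce\<close>)
  ultimately show ?thesis by simp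
qed

text \<open>The exponentials have modulus at most 1 on the half plane and the weight is at least 1,
  so the weighted norm dominates the supremum norm.\<close>

lemma dirichlet_sum_norm_le:
  assumes "dirichlet_sum \<Lambda> \<omega> K f" "s \<in> right_half_plane"
  shows "norm (f s) \<le> K"
proof -
  obtain F where F: "(\<lambda>l. norm (F l) * \<omega> l) summable_on \<Lambda>" "(\<Sum>\<^sub>\<infinity>l\<in>\<Lambda>. norm (F l) * \<omega> l) \<le> K"
    "((\<lambda>l. F l * exp (- (of_real l * s))) has_sum f s) \<Lambda>"
    using assms unfolding dirichlet_sum_def by blast
  have s: "(\<lambda>l. norm (F l * exp (- (of_real l * s)))) summable_on \<Lambda>"
    using summable_evaluate[of F "\<lambda>l. l" \<Lambda> s] F(1) assms(2) by simp
  have "norm (f s) \<le> (\<Sum>\<^sub>\<infinity>l\<in>\<Lambda>. norm (F l * exp (- (of_real l * s))))"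
    by (rule norm_has_sum_bound[OF has_sum_infsum[OF s] F(3)])
  also have "\<dots> \<le> (\<Sum>\<^sub>\<infinity>l\<in>\<Lambda>. norm (F l) * \<omega> l)"
  proof (rule infsum_mono[OF s F(1)])
    fix l assume l: "l \<in> \<Lambda>"
    have "norm (exp (- (of_real l * s))) \<le> \<omega> l"
      using norm_exp_le_1[OF assms(2) nonneg[OF l]] weight_ge_1[OF l] by linarith
    then show "norm (F l * exp (- (of_real l * s))) \<le> norm (F l) * \<omega> l"
      by (simp add: norm_mult mult_left_mono del: norm_exp_eq_Re)
  qed
  finally show ?thesis using F(2) by linarith
qed

lemma dirichlet_sum_monomial:
  assumes "l \<in> \<Lambda>"
  shows "dirichlet_sum \<Lambda> \<omega> (norm a * \<omega> l) (\<lambda>s. a * exp (- (of_real l * s)))"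
  by (rule dirichlet_sumI[where I="{()}" and \<phi>="\<lambda>_. l" and c="\<lambda>_. a"])
    (use assms in \<open>auto simp: has_sum_finite_iff\<close>)

lemma dirichlet_sum_const: "dirichlet_sum \<Lambda> \<omega> (norm a) (\<lambda>s. a)"
  using dirichlet_sum_monomial[OF zero_in, of a] by (simp add: weight_0)

text \<open>The product is a series over pairs \<open>(a, b)\<close> with frequency
  \<open>a + b\<close>; submultiplicativity of the weight bounds its norm by the product of the two
  norms.\<close>

lemma dirichlet_sum_mult:
  assumes "dirichlet_sum \<Lambda> \<omega> K f" "dirichlet_sum \<Lambda> \<omega> L g"
  shows "dirichlet_sum \<Lambda> \<omega> (K * L) (\<lambda>s. f s * g s)"
proof -
  obtain F where F: "(\<lambda>l. norm (F l) * \<omega> l) summable_on \<Lambda>" "(\<Sum>\<^sub>\<infinity>l\<in>\<Lambda>. norm (F l) * \<omega> l) \<le> K"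
    "\<And>s. s \<in> right_half_plane \<Longrightarrow> ((\<lambda>l. F l * exp (- (of_real l * s))) has_sum f s) \<Lambda>"
    using assms(1) unfolding dirichlet_sum_def by blast
  obtain G where G: "(\<lambda>l. norm (G l) * \<omega> l) summable_on \<Lambda>" "(\<Sum>\<^sub>\<infinity>l\<in>\<Lambda>. norm (G l) * \<omega> l) \<le> L"
    "\<And>s. s \<in> right_half_plane \<Longrightarrow> ((\<lambda>l. G l * exp (- (of_real l * s))) has_sum g s) \<Lambda>"
    using assms(2) unfolding dirichlet_sum_def by blast
  define u v where "u = (\<lambda>l. norm (F l) * \<omega> l)" and "v = (\<lambda>l. norm (G l) * \<omega> l)"
  define c where "c = (\<lambda>(a, b). F a * G b)"
  define \<phi> where "\<phi> = (\<lambda>(a::real, b::real). a + b)"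
  have \<omega>0: "\<omega> l \<ge> 0" if "l \<in> \<Lambda>" for l
    using weight_ge_1[OF that] by simp
  have uv: "(\<lambda>(a, b). u a * v b) summable_on (\<Lambda> \<times> \<Lambda>)"
    using F(1) G(1) \<omega>0 unfolding u_def v_def by (intro summable_on_product_real) auto
  have le: "norm (c p) * \<omega> (\<phi> p) \<le> (\<lambda>(a, b). u a * v b) p" if p: "p \<in> \<Lambda> \<times> \<Lambda>" for p
  proof -
    obtain a b where [simp]: "p = (a, b)" and ab: "a \<in> \<Lambda>" "b \<in> \<Lambda>"
      using p by blast
    have "norm (F a) * norm (G b) * \<omega> (a + b) \<le> norm (F a) * norm (G b) * (\<omega> a * \<omega> b)"
      by (intro mult_left_mono weight_add ab) auto
    then show ?thesis
      by (simp add: c_def \<phi>_def u_def v_def norm_mult mult_ac)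
  qed
  have \<phi>: "\<phi> p \<in> \<Lambda>" if "p \<in> \<Lambda> \<times> \<Lambda>" for p
    using that add_in by (auto simp: \<phi>_def)
  have summ: "(\<lambda>p. norm (c p) * \<omega> (\<phi> p)) summable_on (\<Lambda> \<times> \<Lambda>)"
    by (rule summable_on_comparison_test[OF uv le]) (use \<omega>0 \<phi> in auto)
  show ?thesis
  proof (rule dirichlet_sumI[OF \<phi> summ])
    have "(\<Sum>\<^sub>\<infinity>p\<in>\<Lambda> \<times> \<Lambda>. norm (c p) * \<omega> (\<phi> p)) \<le> (\<Sum>\<^sub>\<infinity>(a, b)\<in>\<Lambda> \<times> \<Lambda>. u a * v b)"
      by (rule infsum_mono[OF summ uv le])
    also have "\<dots> = (\<Sum>\<^sub>\<infinity>a\<in>\<Lambda>. \<Sum>\<^sub>\<infinity>b\<in>\<Lambda>. u a * v b)"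
      using infsum_Sigma_banach[OF uv] by simp
    also have "\<dots> = infsum u \<Lambda> * infsum v \<Lambda>"
      by (simp add: infsum_cmult_right' infsum_cmult_left')
    also have "\<dots> \<le> K * L"
      using F(2) G(2) dirichlet_sum_nonneg[OF assms(1)] \<omega>0 unfolding u_def v_def
      by (intro mult_mono infsum_nonneg) auto
    finally show "(\<Sum>\<^sub>\<infinity>p\<in>\<Lambda> \<times> \<Lambda>. norm (c p) * \<omega> (\<phi> p)) \<le> K * L" .
  next
    fix s assume s: "s \<in> right_half_plane"
    have "((\<lambda>p. c p * exp (- (of_real (\<phi> p) * s))) has_sum f s * g s) (Sigma \<Lambda> (\<lambda>_. \<Lambda>))"
    proof (rule has_sum_SigmaI)
      show "(\<lambda>p. c p * exp (- (of_real (\<phi> p) * s))) summable_on \<Lambda> \<times> \<Lambda>"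
        by (rule abs_summable_summable[OF summable_evaluate[OF summ \<phi> s]])
      show "((\<lambda>a. F a * exp (- (of_real a * s)) * g s) has_sum f s * g s) \<Lambda>"
        by (rule has_sum_cmult_left[OF F(3)[OF s]])
      show "((\<lambda>b. c (a, b) * exp (- (of_real (\<phi> (a, b)) * s))) has_sum
              F a * exp (- (of_real a * s)) * g s) \<Lambda>" for a
      proof -
        have "exp (- (of_real (a + b) * s)) = exp (- (of_real a * s)) * exp (- (of_real b * s))" for b
          by (simp add: ring_distribs flip: exp_add)
        then show ?thesis
          using has_sum_cmult_right[OF G(3)[OF s], of "F a * exp (- (of_real a * s))"]
          by (simp add: c_def \<phi>_def mult_ac)
      qed
    qed
    then show "((\<lambda>p. c p * exp (- (of_real (\<phi> p) * s))) has_sum f s * g s) (\<Lambda> \<times> \<Lambda>)" .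
  qed
qed

lemma dirichlet_sum_power:
  assumes "dirichlet_sum \<Lambda> \<omega> K f"
  shows "dirichlet_sum \<Lambda> \<omega> (K ^ n) (\<lambda>s. f s ^ n)"
proof (induction n)
  case 0
  then show ?case using dirichlet_sum_const[of 1] by simp
next
  case (Suc n)
  then show ?case using dirichlet_sum_mult[OF assms Suc] by simp
qed

text \<open>The double series over pairs \<open>(j, l)\<close> converges absolutely because its
  inner sums are at most \<open>K j\<close>. For infinite \<open>J\<close> this replaces an appeal
  to completeness of the algebra.\<close>

lemma dirichlet_sum_series:
  fixes J :: "'j set"
  assumes f: "\<And>j. j \<in> J \<Longrightarrow> dirichlet_sum \<Lambda> \<omega> (K j) (f j)" and K: "K summable_on J"
    and g: "\<And>s. s \<in> right_half_plane \<Longrightarrow> ((\<lambda>j. f j s) has_sum g s) J"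
  shows "dirichlet_sum \<Lambda> \<omega> (infsum K J) g"
proof -
  have "\<exists>F. \<forall>j\<in>J. (\<lambda>l. norm (F j l) * \<omega> l) summable_on \<Lambda> \<and>
      (\<Sum>\<^sub>\<infinity>l\<in>\<Lambda>. norm (F j l) * \<omega> l) \<le> K j \<and>
      (\<forall>s\<in>right_half_plane. ((\<lambda>l. F j l * exp (- (of_real l * s))) has_sum f j s) \<Lambda>)"
    by (rule bchoice) (use f in \<open>simp add: dirichlet_sum_def\<close>)
  then obtain F where F: "\<And>j. j \<in> J \<Longrightarrow> (\<lambda>l. norm (F j l) * \<omega> l) summable_on \<Lambda>"
    "\<And>j. j \<in> J \<Longrightarrow> (\<Sum>\<^sub>\<infinity>l\<in>\<Lambda>. norm (F j l) * \<omega> l) \<le> K j"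
    "\<And>j s. j \<in> J \<Longrightarrow> s \<in> right_half_plane \<Longrightarrow> ((\<lambda>l. F j l * exp (- (of_real l * s))) has_sum f j s) \<Lambda>"
    by blast
  define c where "c = (\<lambda>(j, l). F j l)"
  define N where "N = (\<lambda>j. \<Sum>\<^sub>\<infinity>l\<in>\<Lambda>. norm (F j l) * \<omega> l)"
  have \<omega>0: "\<omega> l \<ge> 0" if "l \<in> \<Lambda>" for l
    using weight_ge_1[OF that] by simp
  have N0: "N j \<ge> 0" for j
    unfolding N_def using \<omega>0 by (intro infsum_nonneg) auto
  have N: "N summable_on J"
    by (rule summable_on_comparison_test[OF K]) (use N0 F(2) in \<open>auto simp: N_def\<close>)
  have inner: "((\<lambda>l. norm (c (j, l)) * \<omega> (snd (j, l))) has_sum N j) \<Lambda>" if "j \<in> J" for j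
    unfolding N_def c_def using F(1)[OF that] by simp
  have summ: "(\<lambda>p. norm (c p) * \<omega> (snd p)) summable_on (J \<times> \<Lambda>)"
    by (rule summable_on_SigmaI[OF inner N]) (use \<omega>0 in auto)
  show ?thesis
  proof (rule dirichlet_sumI[OF _ summ])
    have "(N has_sum (\<Sum>\<^sub>\<infinity>p\<in>J \<times> \<Lambda>. norm (c p) * \<omega> (snd p))) J"
      using has_sum_infsum[OF summ] inner by (rule has_sum_SigmaD)
    then have "(\<Sum>\<^sub>\<infinity>p\<in>J \<times> \<Lambda>. norm (c p) * \<omega> (snd p)) = infsum N J"
      by (simp add: has_sum_iff)
    also have "\<dots> \<le> infsum K J"
      by (rule infsum_mono[OF N K]) (use F(2) in \<open>auto simp: N_def\<close>)
    finally show "(\<Sum>\<^sub>\<infinity>p\<in>J \<times> \<Lambda>. norm (c p) * \<omega> (snd p)) \<le> infsum K J" .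
  next
    fix s assume s: "s \<in> right_half_plane"
    show "((\<lambda>p. c p * exp (- (of_real (snd p) * s))) has_sum g s) (J \<times> \<Lambda>)"
    proof (rule has_sum_SigmaI)
      show "((\<lambda>l. c (j, l) * exp (- (of_real (snd (j, l)) * s))) has_sum f j s) \<Lambda>" if "j \<in> J" for j
        using F(3)[OF that s] by (simp add: c_def)
      show "(\<lambda>p. c p * exp (- (of_real (snd p) * s))) summable_on J \<times> \<Lambda>"
        by (rule abs_summable_summable[OF summable_evaluate[OF summ _ s]]) auto
    qed (rule g[OF s])
  qed auto
qed

lemma dirichlet_sum_finite_sum:
  assumes "finite J" "\<And>j. j \<in> J \<Longrightarrow> dirichlet_sum \<Lambda> \<omega> (K j) (f j)"
  shows "dirichlet_sum \<Lambda> \<omega> (\<Sum>j\<in>J. K j) (\<lambda>s. \<Sum>j\<in>J. f j s)"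
  using dirichlet_sum_series[of J K f "\<lambda>s. \<Sum>j\<in>J. f j s"] assms by simp

lemma dirichlet_sum_finite_prod:
  assumes "finite J" "\<And>j. j \<in> J \<Longrightarrow> dirichlet_sum \<Lambda> \<omega> (K j) (f j)"
  shows "dirichlet_sum \<Lambda> \<omega> (\<Prod>j\<in>J. K j) (\<lambda>s. \<Prod>j\<in>J. f j s)"
  using assms
proof (induction J)
  case empty
  then show ?case using dirichlet_sum_const[of 1] by simp
next
  case (insert j J)
  then show ?case using dirichlet_sum_mult[of "K j" "f j" "prod K J" "\<lambda>s. \<Prod>j\<in>J. f j s"] by simp
qed

text \<open>Newman's expansion \<open>1 / (P - E) = (\<Sum>n. E ^ n / P ^ Suc n)\<close>: what counts is the growth of
  the norms of \<open>1 / P ^ n\<close>, not the norm of \<open>1 / P\<close>.\<close>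

lemma dirichlet_sum_inverse_diff:
  assumes P: "\<And>n. dirichlet_sum \<Lambda> \<omega> (C * r ^ n) (\<lambda>s. 1 / P s ^ n)"
    and P0: "\<And>s. s \<in> right_half_plane \<Longrightarrow> P s \<noteq> 0"
    and E: "dirichlet_sum \<Lambda> \<omega> \<eta> E" and r: "r \<ge> 0" "\<eta> * r < 1"
  shows "\<exists>K. dirichlet_sum \<Lambda> \<omega> K (\<lambda>s. 1 / (P s - E s))"
proof -
  have \<eta>: "\<eta> \<ge> 0"
    by (rule dirichlet_sum_nonneg[OF E])
  \<comment> \<open>\<open>K n\<close> bounds the norm of \<open>E ^ n / P ^ Suc n\<close>: it is
    \<open>\<eta> ^ n\<close> times \<open>C * r ^ Suc n\<close>.\<close>
  define K where "K = (\<lambda>n. C * r * (\<eta> * r) ^ n)"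
  have sK: "K summable_on UNIV"
    unfolding K_def
    by (intro summable_on_cmult_right norm_summable_imp_summable_on)
      (use \<eta> r in \<open>auto simp: norm_power abs_mult intro!: summable_geometric\<close>)
  have "dirichlet_sum \<Lambda> \<omega> (infsum K UNIV) (\<lambda>s. 1 / (P s - E s))"
  proof (rule dirichlet_sum_series[where f="\<lambda>n s. E s ^ n * (1 / P s ^ Suc n)"])
    show "dirichlet_sum \<Lambda> \<omega> (K n) (\<lambda>s. E s ^ n * (1 / P s ^ Suc n))" for n
      using dirichlet_sum_mult[OF dirichlet_sum_power[OF E, of n] P[of "Suc n"]]
      by (simp add: K_def power_mult_distrib mult_ac)
    fix s assume s: "s \<in> right_half_plane"
    define q where "q = E s / P s"
    \<comment> \<open>Since \<open>C\<close> may exceed 1, the case \<open>n = 1\<close> need not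
      give \<open>norm q < 1\<close>. Summability of all the powers does.\<close>
    have "norm (q ^ n) \<le> C * (\<eta> * r) ^ n" for n
      using dirichlet_sum_norm_le[OF dirichlet_sum_mult[OF dirichlet_sum_power[OF E, of n] P[of n]] s]
      by (simp add: q_def power_divide power_mult_distrib mult_ac)
    moreover have "summable (\<lambda>n. C * (\<eta> * r) ^ n)"
      by (rule summable_mult[OF summable_geometric]) (use \<eta> r in simp)
    ultimately have "summable (\<lambda>n. q ^ n)"
      using summable_comparison_test'[of "\<lambda>n. C * (\<eta> * r) ^ n" 0 "\<lambda>n. q ^ n"] by blast
    then have q: "norm q < 1"
      by (simp add: summable_geometric_iff)
    have "summable (\<lambda>n. norm (q ^ n))"
      using q by (simp add: norm_power)
    then have "((\<lambda>n. q ^ n) has_sum 1 / (1 - q)) UNIV"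
      by (rule norm_summable_imp_has_sum) (rule geometric_sums[OF q])
    then have "((\<lambda>n. 1 / P s * q ^ n) has_sum 1 / P s * (1 / (1 - q))) UNIV"
      by (rule has_sum_cmult_right)
    moreover have "1 / P s * (1 / (1 - q)) = 1 / (P s - E s)"
      using P0[OF s] by (simp add: q_def diff_divide_eq_iff)
    moreover have "1 / P s * q ^ n = E s ^ n * (1 / P s ^ Suc n)" for n
      by (simp add: q_def power_divide)
    ultimately show "((\<lambda>n. E s ^ n * (1 / P s ^ Suc n)) has_sum 1 / (P s - E s)) UNIV"
      by simp
  qed (rule sK)
  then show ?thesis by blast
qed

end

section \<open>Bounding coefficients by shifting the line of integration\<close>

lemma convex_vertical_strip: "convex {s. a \<le> Re s \<and> Re s \<le> b}"
proof -
  have "{s. a \<le> Re s \<and> Re s \<le> b} = {s. Re s \<ge> a} \<inter> {s. Re s \<le> b}"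
    by auto
  then show ?thesis
    by (simp add: convex_Int convex_halfspace_Re_ge convex_halfspace_Re_le)
qed

text \<open>The mean value inequality on the convex strip takes the place of the estimate of an
  integral by the maximum of the integrand times the length of the segment.\<close>

lemma primitive_diff_le:
  assumes deriv: "\<And>s. Re s > - \<alpha> \<Longrightarrow> (\<Phi> has_field_derivative h s) (at s)"
    and bound: "\<And>s. a \<le> Re s \<Longrightarrow> Re s \<le> b \<Longrightarrow> norm (h s) \<le> M"
    and "- \<alpha> < a" "a \<le> Re x" "Re x \<le> b" "a \<le> Re y" "Re y \<le> b"
  shows "norm (\<Phi> x - \<Phi> y) \<le> M * norm (x - y)"
  by (rule field_differentiable_bound[OF convex_vertical_strip[of a b] has_field_derivative_at_within[OF deriv]])
    (use assms in auto)

text \<open>This is division by \<open>T\<close> followed by the limit \<open>T\<close> to infinity,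
  where the bounded contribution \<open>c\<close> disappears.\<close>

lemma le_if_linear_growth_le:
  fixes x y c :: real
  assumes "\<And>T. T > 0 \<Longrightarrow> T * x \<le> T * y + c"
  shows "x \<le> y"
proof (rule ccontr)
  assume "\<not> x \<le> y"
  then have "x - y > 0" by simp
  define T where "T = (\<bar>c\<bar> + 1) / (x - y)"
  have "T > 0" "T * (x - y) = \<bar>c\<bar> + 1"
    using \<open>x - y > 0\<close> by (auto simp: T_def)
  then show False
    using assms[of T] by (simp add: algebra_simps)
qed

text \<open>Adding \<open>x\<close> to a good finite set only shrinks the tail of a nonnegative
  family. Having \<open>x\<close> in \<open>M\<close> allows the term of a given frequency to be
  isolated within the finite part.\<close>

lemma summable_on_small_tail:
  fixes v :: "'a \<Rightarrow> real"
  assumes v: "v summable_on L" "\<And>l. l \<in> L \<Longrightarrow> v l \<ge> 0" and "x \<in> L" "\<eta> > 0"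
  obtains M where "finite M" "M \<subseteq> L" "x \<in> M" "infsum v (L - M) \<le> \<eta>"
proof -
  obtain M where M: "finite M" "M \<subseteq> L" "dist (sum v M) (infsum v L) \<le> \<eta>"
    using infsum_finite_approximation[OF v(1) \<open>\<eta> > 0\<close>] by blast
  have "infsum v (L - insert x M) = infsum v L - infsum v (insert x M)"
    by (rule infsum_Diff) (use v M \<open>x \<in> L\<close> in auto)
  also have "\<dots> = infsum v L - sum v (insert x M)"
    using M by simp
  finally have "infsum v (L - insert x M) = infsum v L - sum v (insert x M)" .
  moreover have "sum v M \<le> sum v (insert x M)"
    by (rule sum_mono2) (use M v \<open>x \<in> L\<close> in auto)
  ultimately have "infsum v (L - insert x M) \<le> \<eta>"
    using M(3) by (simp add: dist_real_def abs_le_iff)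
  then show ?thesis
    using that[of "insert x M"] M \<open>x \<in> L\<close> by auto
qed

text \<open>The coefficient of frequency \<open>m\<close> is the mean of \<open>h s * exp (m * s)\<close> over the line
  \<open>Re s = \<sigma>\<close>. Moving the line to \<open>Re s = - \<beta>\<close> costs only the two horizontal segments, which are
  bounded and disappear in the mean. All integrals are increments of primitives.\<close>

lemma dirichlet_coefficient_bound:
  fixes h :: "complex \<Rightarrow> complex" and u :: "real \<Rightarrow> complex"
  assumes holo: "h holomorphic_on {s. Re s > - \<alpha>}"
    and bound: "\<And>s. Re s > - \<alpha> \<Longrightarrow> norm (h s) \<le> B"
    and \<beta>: "0 \<le> \<beta>" "\<beta> < \<alpha>" and \<sigma>: "\<sigma> \<ge> 0"
    and summ: "(\<lambda>l. norm (u l) * exp (- (l * \<sigma>))) summable_on L"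
    and h: "\<And>s. Re s = \<sigma> \<Longrightarrow> ((\<lambda>l. u l * exp (- (of_real l * s))) has_sum h s) L"
    and m: "m \<in> L" "m \<ge> 0"
  shows "norm (u m) \<le> B * exp (- (\<beta> * m))"
proof (rule field_le_epsilon)
  fix \<eta> :: real assume "\<eta> > 0"
  define v where "v = (\<lambda>l. norm (u l) * exp (- (l * \<sigma>)))"
  \<comment> \<open>The factor \<open>exp (- (m * \<sigma>))\<close> compensates for the modulus of
    \<open>exp (m * s)\<close> on the line \<open>Re s = \<sigma>\<close>.\<close>
  obtain M where M: "finite M" "M \<subseteq> L" "m \<in> M" "infsum v (L - M) \<le> \<eta> * exp (- (m * \<sigma>))"
    using summable_on_small_tail[of v L m "\<eta> * exp (- (m * \<sigma>))"] summ m \<open>\<eta> > 0\<close> by (auto simp: v_def)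
  \<comment> \<open>After multiplication by \<open>exp (m * s)\<close> the term of frequency
    \<open>m\<close> becomes the constant \<open>u m\<close>.\<close>
  define k where "k = (\<lambda>s. h s * exp (of_real m * s))"
  have B0: "B \<ge> 0"
    using order_trans[OF norm_ge_zero bound[of 0]] \<beta> by simp
  have "convex {s. Re s > - \<alpha>}" "open {s. Re s > - \<alpha>}"
    by (simp_all add: convex_halfspace_Re_gt open_halfspace_Re_gt)
  moreover have "k holomorphic_on {s. Re s > - \<alpha>}"
    unfolding k_def by (intro holomorphic_intros holo)
  ultimately obtain \<Phi> where "\<And>s. s \<in> {s. Re s > - \<alpha>} \<Longrightarrow> (\<Phi> has_field_derivative k s) (at s within {s. Re s > - \<alpha>})"
    using holomorphic_convex_primitive' by blast
  then have \<Phi>: "(\<Phi> has_field_derivative k s) (at s)" if "Re s > - \<alpha>" for s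
    using that at_within_open[OF _ \<open>open {s. Re s > - \<alpha>}\<close>, of s] by fastforce
  have k_le: "norm (k s) \<le> B * exp (m * Re s)" if "Re s > - \<alpha>" for s
    using bound[OF that] by (simp add: k_def norm_mult)
  \<comment> \<open>\<open>G\<close> is a primitive of the other terms of the finite part. No
    exponent \<open>m - \<mu>\<close> vanishes, so \<open>G\<close> stays bounded on the line and
    contributes nothing to the mean.\<close>
  define G where "G = (\<lambda>s. \<Sum>\<mu>\<in>M - {m}. u \<mu> * exp (of_real (m - \<mu>) * s) / of_real (m - \<mu>))"
  define g where "g = (\<lambda>s. \<Sum>\<mu>\<in>M - {m}. u \<mu> * exp (of_real (m - \<mu>) * s))"
  have G: "(G has_field_derivative g s) (at s)" for s
    unfolding G_def g_def
  proof (rule DERIV_sum)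
    fix \<mu> assume \<mu>: "\<mu> \<in> M - {m}"
    define d where "d = complex_of_real (m - \<mu>)"
    have "d \<noteq> 0" using \<mu> by (simp add: d_def)
    then have "((\<lambda>s. u \<mu> * exp (d * s) / d) has_field_derivative u \<mu> * exp (d * s)) (at s)"
      by (auto intro!: derivative_eq_intros)
    then show "((\<lambda>s. u \<mu> * exp (of_real (m - \<mu>) * s) / of_real (m - \<mu>)) has_field_derivative
        u \<mu> * exp (of_real (m - \<mu>) * s)) (at s)"
      unfolding d_def .
  qed
  define c where "c = (\<Sum>\<mu>\<in>M - {m}. norm (u \<mu>) * exp ((m - \<mu>) * \<sigma>) / \<bar>m - \<mu>\<bar>)"
  have G_le: "norm (G s) \<le> c" if "Re s = \<sigma>" for s
    unfolding G_def c_def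
    by (rule sum_norm_le) (use that in \<open>simp add: norm_mult norm_divide flip: of_real_diff\<close>)
  \<comment> \<open>The derivative of \<open>\<Psi>\<close> is what the tail outside
    \<open>M\<close> contributes; on the line it has modulus at most \<open>\<eta>\<close>.\<close>
  define \<Psi> where "\<Psi> = (\<lambda>s. \<Phi> s - G s - u m * s)"
  have \<Psi>: "(\<Psi> has_field_derivative k s - g s - u m) (at s)" if "Re s > - \<alpha>" for s
    unfolding \<Psi>_def by (rule derivative_eq_intros \<Phi>[OF that] G refl | simp)+
  have \<Psi>_le: "norm (k s - g s - u m) \<le> \<eta>" if s: "Re s = \<sigma>" for s
  proof -
    have "g s + u m = (\<Sum>\<mu>\<in>M. u \<mu> * exp (of_real (m - \<mu>) * s))"
      unfolding g_def using M by (simp add: sum.remove[of M m])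
    also have "\<dots> = (\<Sum>\<mu>\<in>M. u \<mu> * exp (- (of_real \<mu> * s))) * exp (of_real m * s)"
      unfolding sum_distrib_right
      by (rule sum.cong) (simp_all add: ring_distribs flip: exp_add)
    finally have "k s - g s - u m = (h s - (\<Sum>\<mu>\<in>M. u \<mu> * exp (- (of_real \<mu> * s)))) * exp (of_real m * s)"
      unfolding k_def by (simp add: algebra_simps)
    moreover have "norm (h s - (\<Sum>\<mu>\<in>M. u \<mu> * exp (- (of_real \<mu> * s)))) \<le> infsum v (L - M)"
    proof (rule norm_has_sum_bound)
      show "((\<lambda>l. u l * exp (- (of_real l * s))) has_sum h s - (\<Sum>\<mu>\<in>M. u \<mu> * exp (- (of_real \<mu> * s)))) (L - M)"
        by (rule has_sum_Diff[OF h[OF s]]) (use M in auto)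
      have "v summable_on (L - M)"
        by (rule summable_on_subset_banach[of _ L]) (use summ in \<open>auto simp: v_def\<close>)
      then have "(v has_sum infsum v (L - M)) (L - M)"
        by (rule has_sum_infsum)
      then show "((\<lambda>l. norm (u l * exp (- (of_real l * s)))) has_sum infsum v (L - M)) (L - M)"
        by (simp add: v_def norm_mult s)
    qed
    ultimately have "norm (k s - g s - u m) \<le> \<eta> * exp (- (m * \<sigma>)) * exp (m * \<sigma>)"
      using M(4) s by (simp add: norm_mult)
    then show ?thesis
      by (simp add: mult.assoc flip: exp_add)
  qed
  define D where "D = B * exp (m * \<sigma>) * (\<sigma> + \<beta>)"
  have "T * (2 * norm (u m)) \<le> T * (2 * (B * exp (- (\<beta> * m)) + \<eta>)) + (2 * c + 2 * D)" if T: "T > 0" for T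
  proof -
    define w x y z where "w = Complex \<sigma> T" and "x = Complex \<sigma> (- T)"
      and "y = Complex (- \<beta>) T" and "z = Complex (- \<beta>) (- T)"
    have wx: "norm (w - x) = 2 * T" and yz: "norm (y - z) = 2 * T"
      and wy: "norm (w - y) = \<sigma> + \<beta>" and xz: "norm (x - z) = \<sigma> + \<beta>"
      using T \<sigma> \<beta> by (simp_all add: w_def x_def y_def z_def cmod_def real_sqrt_mult)
    have 1: "norm (\<Psi> w - \<Psi> x) \<le> \<eta> * (2 * T)"
      unfolding wx[symmetric]
      by (rule primitive_diff_le[OF \<Psi>, where a=\<sigma> and b=\<sigma>]) (use \<beta> \<sigma> \<Psi>_le in \<open>auto simp: w_def x_def\<close>)
    have 2: "norm (\<Phi> y - \<Phi> z) \<le> B * exp (- (\<beta> * m)) * (2 * T)"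
      unfolding yz[symmetric]
    proof (rule primitive_diff_le[OF \<Phi>, where a="-\<beta>" and b="-\<beta>"])
      show "norm (k s) \<le> B * exp (- (\<beta> * m))" if "- \<beta> \<le> Re s" "Re s \<le> - \<beta>" for s
      proof -
        have "Re s = - \<beta>" using that by simp
        then show ?thesis
          using k_le[of s] \<beta> by (simp add: mult.commute)
      qed
    qed (use \<beta> in \<open>auto simp: y_def z_def\<close>)
    have k': "norm (k s) \<le> B * exp (m * \<sigma>)" if "- \<beta> \<le> Re s" "Re s \<le> \<sigma>" for s
    proof -
      have "norm (k s) \<le> B * exp (m * Re s)"
        using k_le that \<beta> by simp
      also have "\<dots> \<le> B * exp (m * \<sigma>)"
        using B0 that m by (intro mult_left_mono) (auto intro: mult_left_mono)
      finally show ?thesis .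
    qed
    have 3: "norm (\<Phi> w - \<Phi> y) \<le> D"
      unfolding D_def wy[symmetric]
      by (rule primitive_diff_le[OF \<Phi>, where a="-\<beta>" and b=\<sigma>]) (use k' \<beta> \<sigma> in \<open>auto simp: w_def y_def\<close>)
    have 4: "norm (\<Phi> x - \<Phi> z) \<le> D"
      unfolding D_def xz[symmetric]
      by (rule primitive_diff_le[OF \<Phi>, where a="-\<beta>" and b=\<sigma>]) (use k' \<beta> \<sigma> in \<open>auto simp: x_def z_def\<close>)
    have 5: "norm (G w) \<le> c" "norm (G x) \<le> c"
      using G_le by (simp_all add: w_def x_def)
    \<comment> \<open>The right side of the rectangle with corners \<open>w\<close>,
      \<open>x\<close>, \<open>z\<close>, \<open>y\<close> is traversed for \<open>\<Phi>\<close>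
      along the other three sides. Only the left side and \<open>\<Psi>\<close> have bounds that
      grow with \<open>T\<close>.\<close>
    have "u m * (w - x) = (\<Phi> w - \<Phi> y) + (\<Phi> y - \<Phi> z) - (\<Phi> x - \<Phi> z) - (G w - G x) - (\<Psi> w - \<Psi> x)"
      by (simp add: \<Psi>_def algebra_simps)
    then have "norm (u m * (w - x)) \<le> norm (\<Phi> w - \<Phi> y) + norm (\<Phi> y - \<Phi> z) + norm (\<Phi> x - \<Phi> z)
        + (norm (G w) + norm (G x)) + norm (\<Psi> w - \<Psi> x)"
      by (simp only:) (intro order_trans[OF norm_triangle_ineq4] order_trans[OF norm_triangle_ineq] add_mono order_refl)
    with 1 2 3 4 5 have "norm (u m) * (2 * T) \<le> D + B * exp (- (\<beta> * m)) * (2 * T) + D + (c + c) + \<eta> * (2 * T)"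
      by (simp add: norm_mult wx)
    then show ?thesis
      by (simp add: algebra_simps)
  qed
  from le_if_linear_growth_le[OF this] show "norm (u m) \<le> B * exp (- (\<beta> * m)) + \<eta>"
    by simp
qed

section \<open>Holomorphy and lower bounds slightly beyond the imaginary axis\<close>

text \<open>On closed discs inside the half plane the terms are dominated by the summable family
  \<open>norm (u l) * exp (\<gamma> * l)\<close>, so the entire partial sums converge uniformly
  there by the Weierstrass test.\<close>

lemma dirichlet_series_holomorphic:
  fixes u :: "real \<Rightarrow> complex"
  assumes summ: "(\<lambda>l. norm (u l) * exp (\<gamma> * l)) summable_on L" and L: "L \<subseteq> {0..}"
  shows "(\<lambda>s. \<Sum>\<^sub>\<infinity>l\<in>L. u l * exp (- (of_real l * s))) holomorphic_on {s. Re s > - \<gamma>}"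
    (is "?g holomorphic_on ?H")
proof -
  have op: "open ?H"
    by (rule open_halfspace_Re_gt)
  have "?g field_differentiable at z" if z: "z \<in> ?H" for z
  proof -
    obtain r where r: "r > 0" "cball z r \<subseteq> ?H"
      using op z open_contains_cball by blast
    have lim: "uniform_limit (cball z r) (\<lambda>X s. \<Sum>l\<in>X. u l * exp (- (of_real l * s))) ?g (finite_subsets_at_top L)"
    proof (rule Weierstrass_m_test_general[OF _ summ])
      fix l s assume "l \<in> L" "s \<in> cball z r"
      then have "- \<gamma> \<le> Re s" "l \<ge> 0"
        using r L by (auto intro: less_imp_le)
      from mult_left_mono[OF this] have "- (l * Re s) \<le> \<gamma> * l"
        by (simp add: mult.commute)
      then show "norm (u l * exp (- (of_real l * s))) \<le> norm (u l) * exp (\<gamma> * l)"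
        by (simp add: norm_mult mult_left_mono)
    qed
    have "?g holomorphic_on ball z r"
    proof (rule holomorphic_uniform_limit[OF _ lim])
      show "\<forall>\<^sub>F X in finite_subsets_at_top L.
          continuous_on (cball z r) (\<lambda>s. \<Sum>l\<in>X. u l * exp (- (of_real l * s))) \<and>
          (\<lambda>s. \<Sum>l\<in>X. u l * exp (- (of_real l * s))) holomorphic_on ball z r"
        by (intro always_eventually allI conjI continuous_intros holomorphic_intros)
    qed auto
    then show ?thesis
      using r(1) by (auto intro: holomorphic_on_imp_differentiable_at)
  qed
  then show ?thesis
    by (simp add: holomorphic_on_def field_differentiable_at_within)
qed

text \<open>A point with \<open>Re s > - \<alpha>\<close> is compared with
  \<open>s + \<alpha>\<close>, where the bound \<open>\<delta>\<close> holds. The difference of the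
  two values is at most the sum of \<open>norm (a l) * (exp (l * \<alpha>) - 1)\<close>, which tends
  to 0 with \<open>\<alpha>\<close> because \<open>S\<close> is finite.\<close>

lemma dirichlet_polynomial_bounded_below:
  fixes a :: "real \<Rightarrow> complex"
  assumes S: "finite S" "S \<subseteq> {0..}"
    and P: "\<And>s. Re s \<ge> 0 \<Longrightarrow> norm (\<Sum>l\<in>S. a l * exp (- (of_real l * s))) \<ge> \<delta>" and "\<delta>' < \<delta>"
  obtains \<alpha> where "\<alpha> > 0" "\<And>s. Re s > - \<alpha> \<Longrightarrow> norm (\<Sum>l\<in>S. a l * exp (- (of_real l * s))) \<ge> \<delta>'"
proof -
  define P where "P = (\<lambda>s. \<Sum>l\<in>S. a l * exp (- (of_real l * s)))"
  have "((\<lambda>t. \<Sum>l\<in>S. norm (a l) * (exp (l * t) - 1)) \<longlongrightarrow> (\<Sum>l\<in>S. norm (a l) * (exp (l * 0) - 1))) (at_right 0)"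
    by (intro tendsto_intros)
  then have "\<forall>\<^sub>F t in at_right 0. (\<Sum>l\<in>S. norm (a l) * (exp (l * t) - 1)) < \<delta> - \<delta>'"
    by (rule order_tendstoD) (use \<open>\<delta>' < \<delta>\<close> in simp)
  then have "\<forall>\<^sub>F t in at_right 0. t > 0 \<and> (\<Sum>l\<in>S. norm (a l) * (exp (l * t) - 1)) < \<delta> - \<delta>'"
    using eventually_at_right_less by eventually_elim simp
  then obtain \<alpha> where \<alpha>: "\<alpha> > 0" "(\<Sum>l\<in>S. norm (a l) * (exp (l * \<alpha>) - 1)) < \<delta> - \<delta>'"
    using eventually_happens trivial_limit_at_right_real by blast
  have "norm (P s) \<ge> \<delta>'" if s: "Re s > - \<alpha>" for s
  proof -
    have "norm (P s - P (s + of_real \<alpha>)) \<le> (\<Sum>l\<in>S. norm (a l) * (exp (l * \<alpha>) - 1))"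
      unfolding P_def sum_subtractf[symmetric]
    proof (rule sum_norm_le)
      fix l assume "l \<in> S"
      with S have l: "l \<ge> 0" by auto
      have "a l * exp (- (of_real l * s)) - a l * exp (- (of_real l * (s + of_real \<alpha>)))
          = a l * (exp (- (of_real l * s)) * of_real (1 - exp (- (l * \<alpha>))))"
        by (simp add: ring_distribs exp_diff exp_minus exp_of_real[symmetric] field_simps)
      also have "norm \<dots> = norm (a l) * (exp (- (l * Re s)) * (1 - exp (- (l * \<alpha>))))"
        using l \<alpha> by (simp add: norm_mult del: of_real_diff)
      also have "\<dots> \<le> norm (a l) * (exp (l * \<alpha>) * (1 - exp (- (l * \<alpha>))))"
      proof -
        have "l * (- \<alpha>) \<le> l * Re s"
          using s l by (intro mult_left_mono) auto
        then show ?thesis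
          using l \<alpha> by (intro mult_left_mono mult_right_mono) auto
      qed
      also have "exp (l * \<alpha>) * (1 - exp (- (l * \<alpha>))) = exp (l * \<alpha>) - 1"
        by (simp add: algebra_simps flip: exp_add)
      finally show "norm (a l * exp (- (of_real l * s)) - a l * exp (- (of_real l * (s + of_real \<alpha>))))
          \<le> norm (a l) * (exp (l * \<alpha>) - 1)" .
    qed
    moreover have "norm (P (s + of_real \<alpha>)) \<ge> \<delta>"
      unfolding P_def by (rule P) (use s in simp)
    ultimately show ?thesis
      using \<alpha>(2) norm_triangle_ineq2[of "P (s + of_real \<alpha>)" "P s"] by (simp add: norm_minus_commute)
  qed
  with \<alpha>(1) show ?thesis
    using that unfolding P_def by blast
qed

section \<open>Inverse powers of Dirichlet polynomials and inversion of scalar series\<close>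

context dirichlet_weight
begin

lemma nat_mult_in: "x \<in> \<Lambda> \<Longrightarrow> real n * x \<in> \<Lambda>"
proof (induction n)
  case (Suc n)
  then show ?case using add_in[of x "real n * x"] by (simp add: algebra_simps)
qed (simp add: zero_in)

text \<open>Root test: by admissibility the roots of the terms tend to
  \<open>exp (- (\<gamma> * x))\<close>, which is less than 1.\<close>

lemma admissible_summable:
  assumes adm: "(\<lambda>n. root n (\<omega> (real n * x))) \<longlonglongrightarrow> 1" and x: "x \<in> \<Lambda>" "x > 0" and "\<gamma> > 0"
  shows "(\<lambda>n::nat. exp (- (\<gamma> * (real n * x))) * \<omega> (real n * x)) summable_on UNIV"
proof (rule norm_summable_imp_summable_on)
  define t where "t = (\<lambda>n::nat. exp (- (\<gamma> * (real n * x))) * \<omega> (real n * x))"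
  have "(\<lambda>n. exp (- (\<gamma> * x)) * root n (\<omega> (real n * x))) \<longlonglongrightarrow> exp (- (\<gamma> * x)) * 1"
    by (intro tendsto_mult tendsto_const adm)
  moreover have "\<forall>\<^sub>F n in sequentially. exp (- (\<gamma> * x)) * root n (\<omega> (real n * x)) = root n (norm (norm (t n)))"
  proof (rule eventually_sequentiallyI[of 1])
    fix n :: nat assume n: "1 \<le> n"
    have "norm (norm (t n)) = exp (- (\<gamma> * x)) ^ n * \<omega> (real n * x)"
      using weight_ge_1[OF nat_mult_in[OF x(1)], of n] by (simp add: t_def abs_mult mult_ac flip: exp_of_nat_mult)
    then show "exp (- (\<gamma> * x)) * root n (\<omega> (real n * x)) = root n (norm (norm (t n)))"
      using n by (simp add: real_root_mult real_root_power_cancel)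
  qed
  ultimately have "(\<lambda>n. root n (norm (norm (t n)))) \<longlonglongrightarrow> exp (- (\<gamma> * x)) * 1"
    by (rule Lim_transform_eventually)
  then show "summable (\<lambda>n. norm (t n))"
    by (rule root_test_convergence) (use x \<open>\<gamma> > 0\<close> in simp)
qed

text \<open>The generators are adjoined one at a time. The new frequencies are
  \<open>a + n * x\<close>, and by submultiplicativity of the weight their terms are dominated by
  those of a product of two convergent series.\<close>

lemma summable_subsemigroup:
  assumes adm: "\<And>l. l \<in> \<Lambda> \<Longrightarrow> (\<lambda>n. root n (\<omega> (real n * l))) \<longlonglongrightarrow> 1"
    and S: "finite S" "S \<subseteq> \<Lambda>" and \<gamma>: "\<gamma> > 0"
  obtains L where "L \<subseteq> \<Lambda>" "additive_semigroup0 L" "S \<subseteq> L"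
    "(\<lambda>l. exp (- (\<gamma> * l)) * \<omega> l) summable_on L"
proof -
  have "\<exists>L\<subseteq>\<Lambda>. additive_semigroup0 L \<and> S \<subseteq> L \<and> (\<lambda>l. exp (- (\<gamma> * l)) * \<omega> l) summable_on L"
    using S
  proof (induction S)
    case empty
    show ?case
      by (rule exI[of _ "{0}"]) (use zero_in in \<open>auto simp: additive_semigroup0_def\<close>)
  next
    case (insert x S)
    then obtain L where L: "L \<subseteq> \<Lambda>" "additive_semigroup0 L" "S \<subseteq> L"
      "(\<lambda>l. exp (- (\<gamma> * l)) * \<omega> l) summable_on L"
      by auto
    show ?case
    \<comment> \<open>For \<open>x = 0\<close> the series over the multiples of \<open>x\<close>
      would diverge, but then \<open>L\<close> already contains \<open>x\<close>.\<close>
    proof (cases "x = 0")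
      case True
      then show ?thesis using L by (auto simp: additive_semigroup0_def)
    next
      case False
      with insert have x: "x \<in> \<Lambda>" "x > 0"
        using nonneg[of x] by auto
      define e where "e = (\<lambda>l. exp (- (\<gamma> * l)) * \<omega> l)"
      have e0: "e l \<ge> 0" if "l \<in> \<Lambda>" for l
        using weight_ge_1[OF that] by (simp add: e_def)
      define \<phi> where "\<phi> = (\<lambda>(a, n::nat). a + real n * x)"
      define L' where "L' = \<phi> ` (L \<times> UNIV)"
      have L': "L' \<subseteq> \<Lambda>"
        using L(1) add_in nat_mult_in x by (fastforce simp: L'_def \<phi>_def)
      have in_L': "a + real n * x \<in> L'" if "a \<in> L" for a n
        using that unfolding L'_def \<phi>_def by (intro image_eqI[of _ _ "(a, n)"]) auto
      have L0: "0 \<in> L" "\<And>a b. a \<in> L \<Longrightarrow> b \<in> L \<Longrightarrow> a + b \<in> L"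
        using L(2) by (auto simp: additive_semigroup0_def)
      have "a + b \<in> L'" if ab: "a \<in> L'" "b \<in> L'" for a b
      proof -
        obtain a1 n b1 m where "a = a1 + real n * x" "a1 \<in> L" "b = b1 + real m * x" "b1 \<in> L"
          using ab unfolding L'_def \<phi>_def by auto
        then show ?thesis
          using in_L'[of "a1 + b1" "n + m"] L0 by (simp add: algebra_simps)
      qed
      then have sg: "additive_semigroup0 L'"
        using L' nonneg in_L'[of 0 0] L0 by (auto simp: additive_semigroup0_def)
      have sub: "insert x S \<subseteq> L'"
        using in_L'[of 0 1] in_L'[of _ 0] L0 L(3) by auto
      \<comment> \<open>A frequency may have several representations \<open>a + n * x\<close>;
        \<open>U\<close> keeps exactly one pair for each.\<close>
      obtain U where U: "U \<subseteq> L \<times> UNIV" "inj_on \<phi> U" "L' = \<phi> ` U"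
        using subset_image_inj[of L' \<phi> "L \<times> UNIV"] unfolding L'_def by auto
      have "(\<lambda>(a, n::nat). e a * e (real n * x)) summable_on (L \<times> UNIV)"
        using L(4) admissible_summable[OF adm[OF x(1)] x \<gamma>] L(1) e0 nat_mult_in[OF x(1)]
        by (intro summable_on_product_real) (auto simp: e_def)
      then have "(\<lambda>(a, n::nat). e a * e (real n * x)) summable_on U"
        by (rule summable_on_subset_banach) (use U in auto)
      then have "(e \<circ> \<phi>) summable_on U"
      proof (rule summable_on_comparison_test)
        fix p assume "p \<in> U"
        then obtain a n where p: "p = (a, n)" and a: "a \<in> \<Lambda>"
          using U(1) L(1) by blast
        define y where "y = real n * x"
        have "y \<in> \<Lambda>"
          unfolding y_def by (rule nat_mult_in[OF x(1)])
        have "exp (- (\<gamma> * a)) * exp (- (\<gamma> * y)) * \<omega> (a + y) \<le>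
            exp (- (\<gamma> * a)) * exp (- (\<gamma> * y)) * (\<omega> a * \<omega> y)"
          by (intro mult_left_mono weight_add a \<open>y \<in> \<Lambda>\<close>) auto
        then have "e (a + y) \<le> e a * e y"
          by (simp add: e_def ring_distribs exp_add exp_diff exp_minus field_simps)
        then show "(e \<circ> \<phi>) p \<le> (case p of (a, n) \<Rightarrow> e a * e (real n * x))"
          by (simp add: p \<phi>_def y_def)
        show "0 \<le> (e \<circ> \<phi>) p"
          using e0[OF add_in[OF a nat_mult_in[OF x(1)]]] by (simp add: p \<phi>_def)
      qed
      then have "e summable_on L'"
        using U summable_on_reindex[OF U(2), of e] by simp
      with L' sg sub show ?thesis
        unfolding e_def by blast
    qed
  qed
  then show ?thesis using that by blast
qed

text \<open>The coefficients of \<open>1 / P ^ n\<close> inherit the factor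
  \<open>(1 / \<delta>') ^ n\<close> from the supremum bound on the larger half plane. The remaining
  factor \<open>C\<close> is the sum of \<open>exp (- (\<gamma> * l)) * \<omega> l\<close> over
  \<open>L\<close> and does not depend on \<open>n\<close>.\<close>

lemma dirichlet_polynomial_inverse_powers:
  fixes a :: "real \<Rightarrow> complex"
  assumes adm: "\<And>l. l \<in> \<Lambda> \<Longrightarrow> (\<lambda>n. root n (\<omega> (real n * l))) \<longlonglongrightarrow> 1"
    and S: "finite S" "S \<subseteq> \<Lambda>"
    and P_def: "P = (\<lambda>s. \<Sum>l\<in>S. a l * exp (- (of_real l * s)))"
    and P: "\<And>s. Re s \<ge> 0 \<Longrightarrow> norm (P s) \<ge> \<delta>" and \<delta>: "0 < \<delta>'" "\<delta>' < \<delta>"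
  shows "\<exists>C. \<forall>n. dirichlet_sum \<Lambda> \<omega> (C * (1 / \<delta>') ^ n) (\<lambda>s. 1 / P s ^ n)"
proof -
  have S0: "S \<subseteq> {0..}"
    using S nonneg by auto
  obtain \<alpha> where \<alpha>: "\<alpha> > 0" "\<And>s. Re s > - \<alpha> \<Longrightarrow> norm (P s) \<ge> \<delta>'"
    using dirichlet_polynomial_bounded_below[OF S(1) S0 _ \<delta>(2), of a] P unfolding P_def by blast
  \<comment> \<open>The coefficients will decay like \<open>exp (- (2 * \<gamma> * l))\<close>,
    where \<open>2 * \<gamma> < \<alpha>\<close>. One factor \<open>exp (- (\<gamma> * l))\<close>
    pays for the weight, the other for holomorphy of the series on
    \<open>Re s > - \<gamma>\<close>.\<close>
  define \<gamma> where "\<gamma> = \<alpha> / 4"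
  have \<gamma>: "\<gamma> > 0" using \<alpha> by (simp add: \<gamma>_def)
  obtain L where L: "L \<subseteq> \<Lambda>" "additive_semigroup0 L" "S \<subseteq> L"
    and sL: "(\<lambda>l. exp (- (\<gamma> * l)) * \<omega> l) summable_on L"
    using summable_subsemigroup[OF adm S \<gamma>] by blast
  interpret L: dirichlet_weight L "\<lambda>_. 1"
    using L by unfold_locales (auto simp: weight_def)

  txt \<open>Far to the right the constant term dominates, and \<open>1 / P\<close> is a Neumann series.\<close>
  define a0 where "a0 = (if 0 \<in> S then a 0 else 0)"
  define S' where "S' = S - {0}"
  have S': "finite S'" "\<And>l. l \<in> S' \<Longrightarrow> l > 0" "S' \<subseteq> L"
    using S0 S L by (force simp: S'_def)+
  have P_split: "P s = a0 + (\<Sum>l\<in>S'. a l * exp (- (of_real l * s)))" for s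
    unfolding P_def a0_def S'_def using S(1) by (auto simp: sum.remove[of S 0])
  have "((\<lambda>x. \<Sum>l\<in>S'. norm (a l) * exp (- (l * x))) \<longlongrightarrow> (\<Sum>l\<in>S'. norm (a l) * 0)) at_top"
  proof (intro tendsto_intros)
    fix l assume "l \<in> S'"
    then have "l > 0" by (rule S')
    then show "((\<lambda>x. exp (- (l * x))) \<longlongrightarrow> 0) at_top"
      by real_asymp
  qed
  then have "\<forall>\<^sub>F x in at_top. (\<Sum>l\<in>S'. norm (a l) * exp (- (l * x))) < \<delta> / 2"
    by (rule order_tendstoD) (use \<delta> in simp)
  then have "\<forall>\<^sub>F x in at_top. 0 \<le> x \<and> (\<Sum>l\<in>S'. norm (a l) * exp (- (l * x))) < \<delta> / 2"
    using eventually_ge_at_top[of 0] by eventually_elim simp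
  from eventually_happens[OF this] obtain \<sigma>
    where \<sigma>: "\<sigma> \<ge> 0" "(\<Sum>l\<in>S'. norm (a l) * exp (- (l * \<sigma>))) < \<delta> / 2"
    by auto
  define \<eta> where "\<eta> = (\<Sum>l\<in>S'. norm (a l) * exp (- (l * \<sigma>)))"
  \<comment> \<open>At \<open>\<sigma>\<close> the modulus of \<open>P\<close> is at least
    \<open>\<delta>\<close>, while the nonconstant terms contribute at most
    \<open>\<eta> < \<delta> / 2\<close>. Hence \<open>norm a0\<close> exceeds
    \<open>\<eta>\<close>; in particular \<open>a0\<close> is not the default value 0.\<close>
  have "norm (P (of_real \<sigma>)) \<le> norm a0 + \<eta>"
    unfolding P_split \<eta>_def
    by (intro order_trans[OF norm_triangle_ineq] add_left_mono sum_norm_le) (simp add: norm_mult)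
  moreover have "norm (P (of_real \<sigma>)) \<ge> \<delta>"
    by (rule P) (use \<sigma> in simp)
  ultimately have a0: "\<eta> < norm a0"
    using \<sigma>(2) by (simp add: \<eta>_def)
  have \<eta>0: "\<eta> \<ge> 0"
    unfolding \<eta>_def by (intro sum_nonneg) auto
  \<comment> \<open>\<open>E\<close> is minus the nonconstant part of \<open>P\<close> translated by
    \<open>\<sigma>\<close>, so that \<open>a0 - E s\<close> is \<open>P (s + \<sigma>)\<close>. The
    translation puts the factors \<open>exp (- (l * \<sigma>))\<close> into the coefficients and
    makes the norm equal to \<open>\<eta>\<close>.\<close>
  define E where "E = (\<lambda>s. \<Sum>l\<in>S'. - a l * exp (- (of_real l * of_real \<sigma>)) * exp (- (of_real l * s)))"
  have "dirichlet_sum L (\<lambda>_. 1) (\<Sum>l\<in>S'. norm (- a l * exp (- (of_real l * of_real \<sigma>))) * 1) E"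
    unfolding E_def
    by (intro L.dirichlet_sum_finite_sum L.dirichlet_sum_monomial) (use S' in auto)
  then have E: "dirichlet_sum L (\<lambda>_. 1) \<eta> E"
    by (simp add: \<eta>_def norm_mult)
  have "\<exists>K. dirichlet_sum L (\<lambda>_. 1) K (\<lambda>s. 1 / (a0 - E s))"
  proof (rule L.dirichlet_sum_inverse_diff[OF _ _ E])
    show "dirichlet_sum L (\<lambda>_. 1) (1 * (1 / norm a0) ^ n) (\<lambda>s. 1 / a0 ^ n)" for n
      using L.dirichlet_sum_const[of "1 / a0 ^ n"] by (simp add: norm_divide norm_power power_one_over)
  next
    have "norm a0 > 0" using a0 \<eta>0 by linarith
    then show "\<eta> * (1 / norm a0) < 1" and "\<And>s. a0 \<noteq> 0"
      using a0 by (auto simp: divide_less_eq)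
  qed simp
  moreover have "a0 - E s = P (s + of_real \<sigma>)" for s
    unfolding P_split E_def by (simp add: ring_distribs exp_diff exp_minus field_simps sum_negf)
  ultimately obtain K where K: "dirichlet_sum L (\<lambda>_. 1) K (\<lambda>s. 1 / P (s + of_real \<sigma>))"
    by auto

  define C where "C = (\<Sum>\<^sub>\<infinity>l\<in>L. exp (- (\<gamma> * l)) * \<omega> l)"
  have "dirichlet_sum \<Lambda> \<omega> (C * (1 / \<delta>') ^ n) (\<lambda>s. 1 / P s ^ n)" for n
  proof -
    define h where "h = (\<lambda>s. 1 / P s ^ n)"
    define B where "B = (1 / \<delta>') ^ n"
    have P0: "P s \<noteq> 0" if "Re s > - \<alpha>" for s
      using \<alpha>(2)[OF that] \<delta> by auto
    have h_holo: "h holomorphic_on {s. Re s > - \<alpha>}"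
      unfolding h_def P_def
      by (intro holomorphic_intros) (use P0 in \<open>auto simp: P_def\<close>)
    have h_le: "norm (h s) \<le> B" if "Re s > - \<alpha>" for s
    proof -
      have "1 / norm (P s) \<le> 1 / \<delta>'"
        using \<alpha>(2)[OF that] \<delta> by (intro frac_le) auto
      from power_mono[OF this, of n] show ?thesis
        by (simp add: h_def B_def norm_divide norm_power power_one_over)
    qed
    \<comment> \<open>The bound \<open>K ^ n\<close> would be too weak in general and is discarded.
      What is kept is the existence of an absolutely convergent expansion far to the right, with
      frequencies in \<open>L\<close>.\<close>
    have "dirichlet_sum L (\<lambda>_. 1) (K ^ n) (\<lambda>s. (1 / P (s + of_real \<sigma>)) ^ n)"
      by (rule L.dirichlet_sum_power[OF K])
    then obtain F where F: "(\<lambda>l. norm (F l) * 1) summable_on L"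
      "\<And>s. s \<in> right_half_plane \<Longrightarrow>
        ((\<lambda>l. F l * exp (- (of_real l * s))) has_sum (1 / P (s + of_real \<sigma>)) ^ n) L"
      unfolding dirichlet_sum_def by blast
    \<comment> \<open>These are the coefficients of \<open>1 / P ^ n\<close> itself, with the
      translation by \<open>\<sigma>\<close> undone.\<close>
    define u where "u = (\<lambda>l. F l * exp (of_real l * of_real \<sigma>))"
    have u_sum: "((\<lambda>l. u l * exp (- (of_real l * s))) has_sum h s) L" if "Re s \<ge> \<sigma>" for s
    proof -
      have "u l * exp (- (of_real l * s)) = F l * exp (- (of_real l * (s - of_real \<sigma>)))" for l
        by (simp add: u_def ring_distribs mult.assoc flip: exp_add)
      then show ?thesis
        using F(2)[of "s - of_real \<sigma>"] that by (simp add: h_def power_one_over right_half_plane_def)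
    qed
    have u_le: "norm (u l) \<le> B * exp (- (2 * \<gamma> * l))" if "l \<in> L" for l
    proof (rule dirichlet_coefficient_bound[OF h_holo h_le])
      have "norm (u l) * exp (- (l * \<sigma>)) = norm (F l)" for l
        by (simp add: u_def norm_mult mult.assoc flip: exp_add)
      then show "(\<lambda>l. norm (u l) * exp (- (l * \<sigma>))) summable_on L"
        using F(1) by simp
    qed (use that L.nonneg \<alpha> \<sigma> u_sum in \<open>auto simp: \<gamma>_def\<close>)
    have B0: "B \<ge> 0"
      using \<delta> by (simp add: B_def)
    have e1: "norm (u l) * exp (\<gamma> * l) \<le> B * exp (- (\<gamma> * l))" if "l \<in> L" for l
    proof -
      have "norm (u l) * exp (\<gamma> * l) \<le> B * exp (- (2 * \<gamma> * l)) * exp (\<gamma> * l)"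
        by (intro mult_right_mono u_le that) auto
      also have "\<dots> = B * exp (- (\<gamma> * l))"
        by (simp add: mult.assoc flip: exp_add)
      finally show ?thesis .
    qed
    have \<omega>1: "\<omega> l \<ge> 1" if "l \<in> L" for l
      using that L weight_ge_1 by auto
    have sB: "(\<lambda>l. B * (exp (- (\<gamma> * l)) * \<omega> l)) summable_on L"
      by (intro summable_on_cmult_right sL)
    have su: "(\<lambda>l. norm (u l) * exp (\<gamma> * l)) summable_on L"
    proof (rule summable_on_comparison_test[OF sB])
      fix l assume l: "l \<in> L"
      have "B * (exp (- (\<gamma> * l)) * 1) \<le> B * (exp (- (\<gamma> * l)) * \<omega> l)"
        by (intro mult_left_mono \<omega>1 l B0) auto
      with e1[OF l] show "norm (u l) * exp (\<gamma> * l) \<le> B * (exp (- (\<gamma> * l)) * \<omega> l)"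
        by simp
    qed auto
    have e2: "norm (u l) * \<omega> l \<le> B * (exp (- (\<gamma> * l)) * \<omega> l)" if "l \<in> L" for l
    proof -
      have "norm (u l) \<le> norm (u l) * exp (\<gamma> * l)"
        using L.nonneg[OF that] \<gamma> by (intro mult_le_cancel_left1[THEN iffD2]) auto
      also note e1[OF that]
      finally have "norm (u l) * \<omega> l \<le> B * exp (- (\<gamma> * l)) * \<omega> l"
        using \<omega>1[OF that] by (intro mult_right_mono) auto
      then show ?thesis by (simp add: mult.assoc)
    qed
    have s\<omega>: "(\<lambda>l. norm (u l) * \<omega> l) summable_on L"
      by (rule summable_on_comparison_test[OF sB e2]) (use \<omega>1 in \<open>fastforce+\<close>)
    \<comment> \<open>The expansion is known for \<open>Re s \<ge> \<sigma>\<close>. The decay of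
      \<open>u\<close> makes the series holomorphic on \<open>Re s > - \<gamma>\<close>, so the
      identity theorem carries the expansion to the closed half plane.\<close>
    have cont: "(\<Sum>\<^sub>\<infinity>l\<in>L. u l * exp (- (of_real l * s))) = h s" if "Re s > - \<gamma>" for s
    proof (rule analytic_continuation_open[where s="{s. Re s > \<sigma>}" and s'="{s. Re s > - \<gamma>}" and z=s])
      have "of_real (\<sigma> + 1) \<in> {s. Re s > \<sigma>}" by simp
      then show "{s. Re s > \<sigma>} \<noteq> {}" by blast
      show "connected {s. Re s > - \<gamma>}"
        by (rule convex_connected[OF convex_halfspace_Re_gt])
      show "h holomorphic_on {s. Re s > - \<gamma>}"
        by (rule holomorphic_on_subset[OF h_holo]) (use \<alpha> in \<open>auto simp: \<gamma>_def\<close>)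
      show "(\<lambda>s. \<Sum>\<^sub>\<infinity>l\<in>L. u l * exp (- (of_real l * s))) holomorphic_on {s. Re s > - \<gamma>}"
        by (rule dirichlet_series_holomorphic[OF su]) (use L.nonneg in auto)
      show "(\<Sum>\<^sub>\<infinity>l\<in>L. u l * exp (- (of_real l * z))) = h z" if "z \<in> {s. Re s > \<sigma>}" for z
        by (rule infsumI[OF u_sum]) (use that in auto)
    qed (use that \<sigma> \<gamma> in \<open>auto simp: open_halfspace_Re_gt\<close>)
    have "dirichlet_sum \<Lambda> \<omega> (B * C) h"
    proof (rule dirichlet_sumI[where I=L and c=u and \<phi>="\<lambda>l. l"])
      show "(\<Sum>\<^sub>\<infinity>l\<in>L. norm (u l) * \<omega> l) \<le> B * C"
        unfolding C_def infsum_cmult_right'[symmetric] by (rule infsum_mono[OF s\<omega> sB e2])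
      show "((\<lambda>l. u l * exp (- (of_real l * s))) has_sum h s) L" if "s \<in> right_half_plane" for s
      proof -
        have "(\<lambda>l. u l * exp (- (of_real l * s))) summable_on L"
          by (rule abs_summable_summable[OF summable_evaluate[where \<phi>="\<lambda>l. l", OF s\<omega> _ that]]) (use L in auto)
        moreover have "Re s > - \<gamma>"
          using that \<gamma> by (simp add: right_half_plane_def)
        ultimately show ?thesis
          using cont[of s] by (simp add: has_sum_iff)
      qed
    qed (use L s\<omega> in auto)
    then show ?thesis
      by (simp add: h_def B_def mult.commute)
  qed
  then show ?thesis by blast
qed

theorem dirichlet_sum_inverse:
  assumes adm: "\<And>l. l \<in> \<Lambda> \<Longrightarrow> (\<lambda>n. root n (\<omega> (real n * l))) \<longlonglongrightarrow> 1"
    and f: "dirichlet_sum \<Lambda> \<omega> K f"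
    and "\<delta> > 0" and bound: "\<And>s. s \<in> right_half_plane \<Longrightarrow> norm (f s) \<ge> \<delta>"
  shows "\<exists>K. dirichlet_sum \<Lambda> \<omega> K (\<lambda>s. 1 / f s)"
proof -
  obtain F where F: "(\<lambda>l. norm (F l) * \<omega> l) summable_on \<Lambda>"
    "\<And>s. s \<in> right_half_plane \<Longrightarrow> ((\<lambda>l. F l * exp (- (of_real l * s))) has_sum f s) \<Lambda>"
    using f unfolding dirichlet_sum_def by blast
  obtain M where M: "finite M" "M \<subseteq> \<Lambda>" "(\<Sum>\<^sub>\<infinity>l\<in>\<Lambda> - M. norm (F l) * \<omega> l) \<le> \<delta> / 4"
    using summable_on_small_tail[OF F(1) _ zero_in, of "\<delta> / 4"] weight_ge_1 \<open>\<delta> > 0\<close>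
    by (smt (verit, best) divide_pos_pos mult_nonneg_nonneg norm_ge_zero)
  define P where "P = (\<lambda>s. \<Sum>l\<in>M. F l * exp (- (of_real l * s)))"
  define E where "E = (\<lambda>s. P s - f s)"
  have E: "dirichlet_sum \<Lambda> \<omega> (\<delta> / 4) E"
  proof (rule dirichlet_sumI[where I="\<Lambda> - M" and c="\<lambda>l. - F l" and \<phi>="\<lambda>l. l"])
    show "(\<lambda>l. norm (- F l) * \<omega> l) summable_on \<Lambda> - M"
      using summable_on_subset_banach[OF F(1), of "\<Lambda> - M"] by simp
    show "((\<lambda>l. - F l * exp (- (of_real l * s))) has_sum E s) (\<Lambda> - M)" if "s \<in> right_half_plane" for s
    proof -
      have "((\<lambda>l. F l * exp (- (of_real l * s))) has_sum - E s) (\<Lambda> - M)"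
        unfolding E_def minus_diff_eq
        by (rule has_sum_Diff[OF F(2)[OF that]]) (use M in \<open>auto simp: P_def\<close>)
      from has_sum_uminus[THEN iffD2, OF this] show ?thesis
        by simp
    qed
  qed (use M in auto)
  have P: "norm (P s) \<ge> 3 * \<delta> / 4" if "s \<in> right_half_plane" for s
    using bound[OF that] dirichlet_sum_norm_le[OF E that] norm_triangle_ineq2[of "f s" "P s"]
    by (simp add: E_def norm_minus_commute)
  \<comment> \<open>A tail of norm \<open>\<delta> / 4\<close> leaves
    \<open>3 * \<delta> / 4\<close> as a lower bound for \<open>P\<close>, and
    \<open>\<delta> / 2\<close> lies strictly below it. With \<open>r = 1 / (\<delta> / 2)\<close>
    the ratio of the expansion is \<open>\<delta> / 4 * r = 1 / 2\<close>.\<close>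
  obtain C where C: "\<And>n. dirichlet_sum \<Lambda> \<omega> (C * (1 / (\<delta> / 2)) ^ n) (\<lambda>s. 1 / P s ^ n)"
    using dirichlet_polynomial_inverse_powers[OF adm M(1,2) P_def, of "3 * \<delta> / 4" "\<delta> / 2"] P \<open>\<delta> > 0\<close>
    by (auto simp: right_half_plane_def)
  have "\<exists>K. dirichlet_sum \<Lambda> \<omega> K (\<lambda>s. 1 / (P s - E s))"
    by (rule dirichlet_sum_inverse_diff[OF C _ E]) (use P \<open>\<delta> > 0\<close> in force)+
  then show ?thesis
    by (simp add: E_def)
qed

end

section \<open>Passing between matrices and their entries\<close>

lemma norm_entry_le_opnorm:
  fixes A :: "complex^'n::finite^'n"
  shows "norm (A $ i $ j) \<le> opnorm A"
proof -
  have "norm (A $ i $ j) = norm ((A *v axis j 1) $ i)"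
    by (simp add: matrix_vector_mult_def axis_def if_distrib cong: if_cong)
  also have "\<dots> \<le> norm (A *v axis j 1)"
    by (rule Finite_Cartesian_Product.norm_nth_le)
  also have "\<dots> \<le> opnorm A * norm (axis j (1::complex))"
    unfolding opnorm_def by (rule onorm[OF matrix_vector_mul_bounded_linear])
  finally show ?thesis by simp
qed

lemma norm_vec_le_sum:
  fixes x :: "'a::real_normed_vector^'n::finite"
  shows "norm x \<le> (\<Sum>i\<in>UNIV. norm (x $ i))"
  unfolding norm_vec_def by (rule L2_set_le_sum) simp

lemma opnorm_le_sum_entries:
  fixes A :: "complex^'n::finite^'n"
  shows "opnorm A \<le> (\<Sum>i\<in>UNIV. \<Sum>j\<in>UNIV. norm (A $ i $ j))"
  unfolding opnorm_def
proof (rule onorm_le)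
  fix x :: "complex^'n"
  have "norm (A *v x) \<le> (\<Sum>i\<in>UNIV. norm ((A *v x) $ i))"
    by (rule norm_vec_le_sum)
  also have "\<dots> \<le> (\<Sum>i\<in>UNIV. \<Sum>j\<in>UNIV. norm (A $ i $ j) * norm x)"
    unfolding matrix_vector_mult_def
    by (auto intro!: sum_mono sum_norm_le mult_left_mono Finite_Cartesian_Product.norm_nth_le simp: norm_mult)
  finally show "norm (A *v x) \<le> (\<Sum>i\<in>UNIV. \<Sum>j\<in>UNIV. norm (A $ i $ j)) * norm x"
    by (simp add: sum_distrib_right)
qed

lemma opnorm_nonneg: "opnorm (A :: complex^'n::finite^'n) \<ge> 0"
  unfolding opnorm_def by (rule onorm_pos_le[OF matrix_vector_mul_bounded_linear])

lemma summable_on_finite_sum: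
  fixes f :: "'i \<Rightarrow> 'a \<Rightarrow> 'b::topological_comm_monoid_add"
  assumes "finite I" "\<And>i. i \<in> I \<Longrightarrow> f i summable_on A"
  shows "(\<lambda>x. \<Sum>i\<in>I. f i x) summable_on A"
  using assms by (induction I) (auto intro: summable_on_add)

lemma has_sum_vecI:
  fixes f :: "'a \<Rightarrow> 'b::real_normed_vector ^ 'n::finite"
  assumes "\<And>i. ((\<lambda>x. f x $ i) has_sum S $ i) A"
  shows "(f has_sum S) A"
  unfolding has_sum_def
proof (rule vec_tendstoI)
  show "((\<lambda>X. sum f X $ i) \<longlongrightarrow> S $ i) (finite_subsets_at_top A)" for i
    using assms[of i] by (simp add: has_sum_def)
qed

lemma has_sum_entry:
  fixes f :: "'a \<Rightarrow> complex^'n::finite^'n"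
  assumes "(f has_sum S) A"
  shows "((\<lambda>x. f x $ i $ j) has_sum S $ i $ j) A"
  by (intro has_sum_bounded_linear[OF bounded_linear_vec_nth] assms)

context dirichlet_weight
begin

text \<open>Each entry is bounded by the operator norm, which in turn is bounded by the sum of the
  moduli of all entries. Weighted summability and the values of the series can therefore be checked
  entry by entry.\<close>

lemma dirichlet_algebra_iff_entries:
  fixes f :: "complex \<Rightarrow> complex^'n::finite^'n"
  shows "f \<in> dirichlet_algebra \<Lambda> \<omega> \<longleftrightarrow> (\<forall>i j. \<exists>K. dirichlet_sum \<Lambda> \<omega> K (\<lambda>s. f s $ i $ j))"
proof (intro iffI allI)
  fix i j :: 'n
  assume "f \<in> dirichlet_algebra \<Lambda> \<omega>"
  then obtain F :: "real \<Rightarrow> complex^'n^'n" where F: "(\<lambda>l. opnorm (F l) * \<omega> l) summable_on \<Lambda>"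
    "\<And>s. s \<in> right_half_plane \<Longrightarrow> f s = (\<Sum>\<^sub>\<infinity>l\<in>\<Lambda>. cscale (exp (- (complex_of_real l * s))) (F l))"
    unfolding dirichlet_algebra_def by blast
  have summ: "(\<lambda>l. norm (F l $ i $ j) * \<omega> l) summable_on \<Lambda>" for i j
    by (rule summable_on_comparison_test[OF F(1)])
      (use weight_ge_1 in \<open>fastforce intro!: mult_right_mono norm_entry_le_opnorm mult_nonneg_nonneg\<close>)+
  show "\<exists>K. dirichlet_sum \<Lambda> \<omega> K (\<lambda>s. f s $ i $ j)"
  proof (rule exI, rule dirichlet_sumI[where \<phi>="\<lambda>l. l" and c="\<lambda>l. F l $ i $ j", OF _ summ order_refl])
    fix s assume s: "s \<in> right_half_plane"
    have "(\<lambda>l. F l $ i $ j * exp (- (of_real l * s))) summable_on \<Lambda>" for i j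
      by (rule abs_summable_summable[OF summable_evaluate[where \<phi>="\<lambda>l. l", OF summ _ s]])
    then have ent: "((\<lambda>l. cscale (exp (- (complex_of_real l * s))) (F l) $ i $ j) has_sum
        (\<Sum>\<^sub>\<infinity>l\<in>\<Lambda>. F l $ i $ j * exp (- (of_real l * s)))) \<Lambda>" for i j
      by (simp add: cscale_def mult.commute)
    have "((\<lambda>l. cscale (exp (- (complex_of_real l * s))) (F l)) has_sum
        (\<chi> i j. \<Sum>\<^sub>\<infinity>l\<in>\<Lambda>. F l $ i $ j * exp (- (of_real l * s)))) \<Lambda>"
      by (intro has_sum_vecI) (use ent in simp)
    then have "((\<lambda>l. cscale (exp (- (complex_of_real l * s))) (F l)) has_sum f s) \<Lambda>"
      using F(2)[OF s] by (simp add: has_sum_iff)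
    from has_sum_entry[OF this, of i j]
    show "((\<lambda>l. F l $ i $ j * exp (- (of_real l * s))) has_sum f s $ i $ j) \<Lambda>"
      by (simp add: cscale_def mult.commute)
  qed
next
  assume "\<forall>i j. \<exists>K. dirichlet_sum \<Lambda> \<omega> K (\<lambda>s. f s $ i $ j)"
  then have "\<forall>i j. \<exists>F. (\<lambda>l. norm (F l) * \<omega> l) summable_on \<Lambda> \<and>
      (\<forall>s\<in>right_half_plane. ((\<lambda>l. F l * exp (- (of_real l * s))) has_sum f s $ i $ j) \<Lambda>)"
    unfolding dirichlet_sum_def by blast
  then obtain F where F: "\<And>i j. (\<lambda>l. norm (F i j l) * \<omega> l) summable_on \<Lambda>"
    "\<And>i j s. s \<in> right_half_plane \<Longrightarrow>
      ((\<lambda>l. F i j l * exp (- (of_real l * s))) has_sum f s $ i $ j) \<Lambda>"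
    unfolding choice_iff by blast
  define G :: "real \<Rightarrow> complex^'n^'n" where "G = (\<lambda>l. \<chi> i j. F i j l)"
  have "(\<lambda>l. opnorm (G l) * \<omega> l) summable_on \<Lambda>"
  proof (rule summable_on_comparison_test)
    show "(\<lambda>l. \<Sum>i\<in>UNIV. \<Sum>j\<in>UNIV. norm (F i j l) * \<omega> l) summable_on \<Lambda>"
      by (intro summable_on_finite_sum F) auto
    fix l assume l: "l \<in> \<Lambda>"
    have \<omega>0: "\<omega> l \<ge> 0"
      using weight_ge_1[OF l] by simp
    from mult_right_mono[OF opnorm_le_sum_entries this, of "G l"]
    show "opnorm (G l) * \<omega> l \<le> (\<Sum>i\<in>UNIV. \<Sum>j\<in>UNIV. norm (F i j l) * \<omega> l)"
      by (simp add: G_def sum_distrib_right)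
    show "0 \<le> opnorm (G l) * \<omega> l"
      by (intro mult_nonneg_nonneg opnorm_nonneg \<omega>0)
  qed
  moreover have "f s = (\<Sum>\<^sub>\<infinity>l\<in>\<Lambda>. cscale (exp (- (complex_of_real l * s))) (G l))"
    if s: "s \<in> right_half_plane" for s
  proof -
    have "((\<lambda>l. cscale (exp (- (complex_of_real l * s))) (G l)) has_sum f s) \<Lambda>"
      by (intro has_sum_vecI) (use F(2)[OF s] in \<open>simp add: cscale_def G_def mult.commute\<close>)
    then show ?thesis
      by (simp add: infsumI)
  qed
  ultimately show "f \<in> dirichlet_algebra \<Lambda> \<omega>"
    unfolding dirichlet_algebra_def by blast
qed

text \<open>The Leibniz formula is a finite sum of finite products of entries.\<close>

lemma dirichlet_sum_det:
  fixes f :: "complex \<Rightarrow> complex^'n::finite^'n"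
  assumes "\<And>i j. \<exists>K. dirichlet_sum \<Lambda> \<omega> K (\<lambda>s. f s $ i $ j)"
  shows "\<exists>K. dirichlet_sum \<Lambda> \<omega> K (\<lambda>s. det (f s))"
proof -
  obtain K where K: "\<And>i j. dirichlet_sum \<Lambda> \<omega> (K i j) (\<lambda>s. f s $ i $ j)"
    using assms by metis
  have "dirichlet_sum \<Lambda> \<omega>
      (\<Sum>p\<in>{p. p permutes UNIV}. norm (of_int (sign p) :: complex) * (\<Prod>i\<in>UNIV. K i (p i)))
      (\<lambda>s. \<Sum>p\<in>{p. p permutes UNIV}. of_int (sign p) * (\<Prod>i\<in>UNIV. f s $ i $ p i))"
    by (intro dirichlet_sum_finite_sum dirichlet_sum_mult dirichlet_sum_const
      dirichlet_sum_finite_prod K) simp_all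
  then show ?thesis
    unfolding det_def by blast
qed

end

section \<open>Cramer's rule and the matrix-valued inversion theorem\<close>

lemma continuous_on_det: "continuous_on S (det :: complex^'n::finite^'n \<Rightarrow> complex)"
  unfolding det_def by (intro continuous_intros)

text \<open>Column \<open>l\<close> of \<open>B\<close> solves the linear system with matrix
  \<open>A\<close> and right-hand side the unit vector \<open>axis l 1\<close>, so Cramer's rule
  gives its entries.\<close>

lemma matrix_inverse_entry:
  fixes A B :: "complex^'n::finite^'n"
  assumes "A ** B = mat 1"
  shows "B $ k $ l = det (\<chi> i j. if j = k then (if i = l then 1 else 0) else A $ i $ j) / det A"
proof -
  have "det A * det B = 1"
    using arg_cong[OF assms, of det] by (simp add: det_mul)
  then have "det A \<noteq> 0" by auto
  moreover have "A *v (B *v axis l 1) = axis l 1"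
    using assms by (simp add: matrix_vector_mul_assoc)
  ultimately have "B *v axis l 1 = (\<chi> k. det (\<chi> i j. if j = k then axis l 1 $ i else A $ i $ j) / det A)"
    using cramer by blast
  from arg_cong[OF this, of "\<lambda>v. v $ k"] show ?thesis
    by (simp add: axis_def matrix_vector_mult_def if_distrib cong: if_cong)
qed

theorem mainTheorem6:
  fixes \<Lambda> :: "real set" and \<omega> :: "real \<Rightarrow> real"
    and f :: "complex \<Rightarrow> complex^'n::finite^'n"
  assumes "additive_semigroup0 \<Lambda>"
    and "admissible_weight \<Lambda> \<omega>"
    and "f \<in> dirichlet_algebra \<Lambda> \<omega>"
  shows "(\<exists>g\<in>dirichlet_algebra \<Lambda> \<omega>. \<forall>s\<in>right_half_plane.
            f s ** g s = mat 1 \<and> g s ** f s = mat 1)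
         \<longleftrightarrow> closure (f ` right_half_plane) \<subseteq> {A. invertible A}"
    (is "?inv \<longleftrightarrow> ?cl")
proof
  interpret dirichlet_weight \<Lambda> \<omega>
    using assms by unfold_locales (auto simp: admissible_weight_def)
  assume ?inv
  then obtain g where g: "g \<in> dirichlet_algebra \<Lambda> \<omega>" "\<And>s. s \<in> right_half_plane \<Longrightarrow> f s ** g s = mat 1"
    by blast
  obtain K where K: "dirichlet_sum \<Lambda> \<omega> K (\<lambda>s. det (g s))"
    using dirichlet_sum_det g(1) unfolding dirichlet_algebra_iff_entries by blast
  \<comment> \<open>Since \<open>det (g s)\<close> is bounded by \<open>K\<close>, the determinant
    of \<open>f s\<close> stays away from 0. This is a closed condition and survives passage to the
    closure.\<close>
  have "1 \<le> K * norm (det A)" if "A \<in> closure (f ` right_half_plane)" for A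
  proof -
    have "closure (f ` right_half_plane) \<subseteq> {A. 1 \<le> K * norm (det A)}"
    proof (rule closure_minimal)
      show "closed {A :: complex^'n^'n. 1 \<le> K * norm (det A)}"
        by (intro closed_Collect_le continuous_intros continuous_on_det)
      show "f ` right_half_plane \<subseteq> {A. 1 \<le> K * norm (det A)}"
      proof clarify
        fix s assume s: "s \<in> right_half_plane"
        have "det (f s) * det (g s) = 1"
          using arg_cong[OF g(2)[OF s], of det] by (simp add: det_mul)
        then have "1 = norm (det (g s)) * norm (det (f s))"
          by (metis norm_mult norm_one mult.commute)
        also have "\<dots> \<le> K * norm (det (f s))"
          by (intro mult_right_mono dirichlet_sum_norm_le[OF K s]) auto
        finally show "1 \<le> K * norm (det (f s))" .
      qed
    qed
    with that show ?thesis by blast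
  qed
  then show ?cl
    by (fastforce simp: invertible_det_nz)
next
  interpret dirichlet_weight \<Lambda> \<omega>
    using assms by unfold_locales (auto simp: admissible_weight_def)
  assume cl: ?cl
  obtain K where K: "\<And>i j. dirichlet_sum \<Lambda> \<omega> (K i j) (\<lambda>s. f s $ i $ j)"
    using assms(3) unfolding dirichlet_algebra_iff_entries by metis
  \<comment> \<open>Boundedness of \<open>f\<close> makes the closure of its range compact. There
    the modulus of the determinant attains its minimum, which is positive by \<open>cl\<close> and
    serves as the lower bound for the scalar theorem.\<close>
  have "norm (f s) \<le> (\<Sum>i\<in>UNIV. \<Sum>j\<in>UNIV. K i j)" if "s \<in> right_half_plane" for s
  proof -
    have "norm (f s) \<le> (\<Sum>i\<in>UNIV. norm (f s $ i))"
      by (rule norm_vec_le_sum)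
    also have "\<dots> \<le> (\<Sum>i\<in>UNIV. \<Sum>j\<in>UNIV. norm (f s $ i $ j))"
      by (intro sum_mono norm_vec_le_sum)
    also have "\<dots> \<le> (\<Sum>i\<in>UNIV. \<Sum>j\<in>UNIV. K i j)"
      by (intro sum_mono dirichlet_sum_norm_le[OF K that])
    finally show ?thesis .
  qed
  then have "bounded (f ` right_half_plane)"
    by (auto simp: bounded_iff)
  then have "compact (closure (f ` right_half_plane))"
    by (simp add: compact_closure)
  then have "compact ((\<lambda>A. norm (det A)) ` closure (f ` right_half_plane))"
    by (intro compact_continuous_image continuous_intros continuous_on_det)
  moreover have "0 \<in> right_half_plane"
    by (simp add: right_half_plane_def)
  then have "closure (f ` right_half_plane) \<noteq> {}"
    by auto
  ultimately obtain A where A: "A \<in> closure (f ` right_half_plane)"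
    "\<And>B. B \<in> closure (f ` right_half_plane) \<Longrightarrow> norm (det A) \<le> norm (det B)"
    using compact_attains_inf[of "(\<lambda>A. norm (det A)) ` closure (f ` right_half_plane)"] by blast
  have "norm (det A) > 0"
    using A(1) cl by (auto simp: invertible_det_nz)
  moreover have lower: "norm (det (f s)) \<ge> norm (det A)" if "s \<in> right_half_plane" for s
    by (intro A(2) subsetD[OF closure_subset] imageI that)
  moreover obtain K' where "dirichlet_sum \<Lambda> \<omega> K' (\<lambda>s. det (f s))"
    using dirichlet_sum_det K by blast
  ultimately obtain J where J: "dirichlet_sum \<Lambda> \<omega> J (\<lambda>s. 1 / det (f s))"
    using dirichlet_sum_inverse assms(2) unfolding admissible_weight_def by blast
  define g where "g = (\<lambda>s. matrix_inv (f s))"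
  have fg: "f s ** g s = mat 1" "g s ** f s = mat 1" if "s \<in> right_half_plane" for s
  proof -
    have "invertible (f s)"
      using subsetD[OF cl subsetD[OF closure_subset imageI[OF that]]] by simp
    then have "f s ** g s = mat 1 \<and> g s ** f s = mat 1"
      unfolding g_def matrix_inv_def invertible_def by (rule someI_ex)
    then show "f s ** g s = mat 1" "g s ** f s = mat 1"
      by blast+
  qed
  have "\<exists>K. dirichlet_sum \<Lambda> \<omega> K (\<lambda>s. g s $ k $ l)" for k l
  proof -
    \<comment> \<open>\<open>h s\<close> is the Cramer matrix for entry \<open>(k, l)\<close> of the
      inverse: column \<open>k\<close> of \<open>f s\<close> is replaced by the unit vector of index
      \<open>l\<close>. Its entries are entries of \<open>f\<close> or constants.\<close>
    define h :: "complex \<Rightarrow> complex^'n^'n"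
      where "h = (\<lambda>s. \<chi> i j. if j = k then (if i = l then 1 else 0) else f s $ i $ j)"
    have "\<exists>K. dirichlet_sum \<Lambda> \<omega> K (\<lambda>s. h s $ i $ j)" for i j
      using K[of i j] dirichlet_sum_const[of 1] dirichlet_sum_const[of 0]
      by (cases "j = k"; cases "i = l") (auto simp: h_def)
    then obtain M where M: "dirichlet_sum \<Lambda> \<omega> M (\<lambda>s. det (h s))"
      using dirichlet_sum_det by blast
    have "dirichlet_sum \<Lambda> \<omega> (M * J) (\<lambda>s. g s $ k $ l)"
      by (rule dirichlet_sum_cong[OF dirichlet_sum_mult[OF M J]])
        (use matrix_inverse_entry[OF fg(1)] in \<open>simp add: h_def\<close>)
    then show ?thesis ..
  qed
  then have "g \<in> dirichlet_algebra \<Lambda> \<omega>"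
    unfolding dirichlet_algebra_iff_entries by blast
  with fg show ?inv by blast
qed

end
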